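(* Let $(X_n)_{n\in\mathbb{N}_0}$ be a transient random walk on a regular language which is weakly symmetric and suffix-irreducible, and let $h=\lim_{n\to\infty}-\frac1n\mathbb{E}[\log\pi_n(X_n)]$ be its asymptotic entropy, where $\pi_n$ is the distribution of $X_n$. Then $h$ is the rate of escape with respect to the Greenian distance, i.e. $$h=\lim_{n\to\infty}\frac1n d_{\mathrm{Green}}(o,X_n)\quad\text{almost surely},$$ where $d_{\mathrm{Green}}(w_1,w_2)=-\log\mathbb{P}[\exists n\in\mathbb{N}_0:X_n=w_2\mid X_0=w_1]$ for $w_1,w_2\in\mathcal{L}$.
   Context: $\mathcal{A}$ is a finite alphabet, $\mathcal{A}^n$ the set of words with exactly $n$ letters, $\mathcal{A}^*$ the set of all finite words including the empty word $o$, and $|w|$ the length of $w$. A random walk on a regular language is a time-homogeneous Markov chain $(X_n)_{n\ge0}$ on $\mathcal{A}^*$ with $X_0=o$ whose only possible one-step transitions are (for $w\in\mathcal{A}^*$ and letters $a_i,b_i\in\mathcal{A}$): from $wa_1a_2$ to $wb_1$, $wb_1b_2$, $wb_1b_2b_3$ with probabilities $p(a_1a_2,b_1)$, $p(a_1a_2,b_1b_2)$, $p(a_1a_2,b_1b_2b_3)$ not depending on $w$; from $a_1$ to $o$, $b_1$, $b_1b_2$ with probabilities $p(a_1,o)$, $p(a_1,b_1)$, $p(a_1,b_1b_2)$; from $o$ to $o$, $b_1$ with probabilities $p(o,o)$, $p(o,b_1)$. $\mathbb{P}_w$ is the law started at $w$ and $\mathcal{L}=\{w:\exists n\in\mathbb{N},\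 \mathbb{P}[X_n=w]>0\}$. Weakly symmetric: for all $u,v\in\mathcal{A}^*$, $\mathbb{P}_u[X_1=v]>0$ implies $\mathbb{P}_v[X_1=u]>0$. Suffix-irreducible: for every $w=w_0a_0b_0\in\mathcal{L}$ ($w_0\in\mathcal{A}^*$, $a_0b_0\in\mathcal{A}^2$) and every $ab\in\mathcal{A}^2$ there are $n\in\mathbb{N}$, $w_1\in\mathcal{A}^*$ with $\mathbb{P}_w[X_n=w_0w_1ab,\ \forall k\le n:|X_k|\ge|w|]>0$. Under these assumptions and transience the limit $h$ exists. *)

theory Defs
  imports "HOL-Probability.Probability"
begin

text \<open>
  Words over the finite alphabet \<open>'a\<close> are lists, the empty word \<open>o\<close> is \<open>[]\<close>.
  The transition probabilities are given by \<open>p\<close>: for a word \<open>s\<close> with at most two letters,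
  \<open>p s\<close> is the distribution \<open>p(s, \<cdot>)\<close> of the word that replaces the suffix \<open>s\<close>.
  Its values on longer words play no role.
\<close>

definition local_transitions :: "('a list \<Rightarrow> 'a list pmf) \<Rightarrow> bool" where
  "local_transitions p \<longleftrightarrow>
     (\<forall>a1 a2. set_pmf (p [a1, a2]) \<subseteq> {b. length b \<in> {1, 2, 3}}) \<and>
     (\<forall>a1. set_pmf (p [a1]) \<subseteq> {b. length b \<in> {0, 1, 2}}) \<and>
     set_pmf (p []) \<subseteq> {b. length b \<in> {0, 1}}"

text \<open>One step from \<open>u\<close> replaces its last two letters (all of \<open>u\<close> if \<open>length u < 2\<close>).\<close>

definition transition_kernel :: "('a list \<Rightarrow> 'a list pmf) \<Rightarrow> 'a list \<Rightarrow> 'a list pmf" where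
  "transition_kernel p u =
     map_pmf (\<lambda>b. take (length u - 2) u @ b) (p (drop (length u - 2) u))"

lemma transition_kernel_append2: "pmf (transition_kernel p (w @ [a1, a2])) (w @ b) = pmf (p [a1, a2]) b"
  by (simp add: transition_kernel_def pmf_map_inj' inj_def)

lemma transition_kernel_singleton: "transition_kernel p [a1] = p [a1]"
  by (simp add: transition_kernel_def pmf.map_ident)

lemma transition_kernel_Nil: "transition_kernel p [] = p []"
  by (simp add: transition_kernel_def pmf.map_ident)

text \<open>
  \<open>P w\<close> is the law of the chain started at \<open>w\<close>; the walk itself is \<open>X\<close> under \<open>P []\<close>.
\<close>

locale regular_language_walk =
  fixes p :: "'a::finite list \<Rightarrow> 'a list pmf"
    and P :: "'a list \<Rightarrow> 'w measure"
    and X :: "nat \<Rightarrow> 'w \<Rightarrow> 'a list"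
  assumes local: "local_transitions p"
    and prob_space_P: "\<And>w. prob_space (P w)"
    and measurable_X: "\<And>w n. X n \<in> P w \<rightarrow>\<^sub>M count_space UNIV"
    and start: "\<And>w. \<P>(\<omega> in P w. X 0 \<omega> = w) = 1"
    and markov: "\<And>w n x v. \<P>(\<omega> in P w. \<forall>i\<le>n. X i \<omega> = x i) > 0 \<Longrightarrow>
      \<P>(\<omega> in P w. X (Suc n) \<omega> = v \<bar> \<forall>i\<le>n. X i \<omega> = x i) = pmf (transition_kernel p (x n)) v"

definition walk_language :: "('a list \<Rightarrow> 'w measure) \<Rightarrow> (nat \<Rightarrow> 'w \<Rightarrow> 'a list) \<Rightarrow> 'a list set" where
  "walk_language P X = {w. \<exists>n. \<P>(\<omega> in P []. X n \<omega> = w) > 0}"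

definition transient :: "('a list \<Rightarrow> 'w measure) \<Rightarrow> (nat \<Rightarrow> 'w \<Rightarrow> 'a list) \<Rightarrow> bool" where
  "transient P X \<longleftrightarrow> (\<forall>w\<in>walk_language P X. \<P>(\<omega> in P w. \<exists>n\<ge>1. X n \<omega> = w) < 1)"

definition weakly_symmetric :: "('a list \<Rightarrow> 'w measure) \<Rightarrow> (nat \<Rightarrow> 'w \<Rightarrow> 'a list) \<Rightarrow> bool" where
  "weakly_symmetric P X \<longleftrightarrow>
     (\<forall>u v. \<P>(\<omega> in P u. X 1 \<omega> = v) > 0 \<longrightarrow> \<P>(\<omega> in P v. X 1 \<omega> = u) > 0)"

definition suffix_irreducible :: "('a list \<Rightarrow> 'w measure) \<Rightarrow> (nat \<Rightarrow> 'w \<Rightarrow> 'a list) \<Rightarrow> bool" where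
  "suffix_irreducible P X \<longleftrightarrow>
     (\<forall>w w0 a0 b0. w = w0 @ [a0, b0] \<and> w \<in> walk_language P X \<longrightarrow>
        (\<forall>a b. \<exists>n w1.
           \<P>(\<omega> in P w. X n \<omega> = w0 @ w1 @ [a, b] \<and> (\<forall>k\<le>n. length (X k \<omega>) \<ge> length w)) > 0))"

definition walk_distribution ::
  "('a list \<Rightarrow> 'w measure) \<Rightarrow> (nat \<Rightarrow> 'w \<Rightarrow> 'a list) \<Rightarrow> nat \<Rightarrow> 'a list \<Rightarrow> real" where
  "walk_distribution P X n w = \<P>(\<omega> in P []. X n \<omega> = w)"

definition entropy_rate ::
  "('a list \<Rightarrow> 'w measure) \<Rightarrow> (nat \<Rightarrow> 'w \<Rightarrow> 'a list) \<Rightarrow> nat \<Rightarrow> real" where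
  "entropy_rate P X n =
     - (1 / real n) * (\<integral>\<omega>. ln (walk_distribution P X n (X n \<omega>)) \<partial>(P []))"

definition asymptotic_entropy :: "('a list \<Rightarrow> 'w measure) \<Rightarrow> (nat \<Rightarrow> 'w \<Rightarrow> 'a list) \<Rightarrow> real" where
  "asymptotic_entropy P X = lim (entropy_rate P X)"

text \<open>
  Only meant for \<open>w1, w2\<close> in the language of the walk, where the hitting probability is positive
  under weak symmetry; elsewhere the convention \<open>ln 0 = 0\<close> would give \<open>0\<close> instead of \<open>\<infinity>\<close>.
\<close>

definition green_dist ::
  "('a list \<Rightarrow> 'w measure) \<Rightarrow> (nat \<Rightarrow> 'w \<Rightarrow> 'a list) \<Rightarrow> 'a list \<Rightarrow> 'a list \<Rightarrow> real" where
  "green_dist P X w1 w2 = - ln \<P>(\<omega> in P w1. \<exists>n. X n \<omega> = w2)"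

end

theory Submission
  imports Defs "HOL-Real_Asymp.Real_Asymp"
begin

text \<open>
  Write $F(x)$ for the probability that the walk ever visits $x$, so that $-\ln F(x)$ is the Green distance
  from the empty word. Since $\pi_n \le F$ and $\sum_{|x| \le n} F(x)$ grows at most linearly, Gibbs'
  inequality shows that the entropy of $X_n$ differs from the mean of $-\ln F(X_n)$ by $O(\ln n)$. It remains
  to prove that $-\ln F(X_n)/n$ converges almost surely and in mean.

  Let $U_N(x)$ be the expected increase of $-\ln F$ over $N$ steps from $x$. Suppose that the oscillation of
  $U_N$ is $o(N)$. The average of the first $N$ iterates of $-\ln F$ under the transition operator is within
  $O(N)$ of $-\ln F$ and has drift $U_N/N$, which is nearly constant. Exponential moments and the
  Borel-Cantelli lemma then give the convergence.

  For the oscillation, let $s$ be a pair of letters from which the walk has a positive chance of never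
  shortening the word. Every word can be transformed into some $ws$ in boundedly many steps with probability
  at least $\delta$. From $ws$, as long as the prefix $w$ is untouched, the increments of $-\ln F$ do not
  depend on $w$ up to a bounded error, because $F(wv)$ and $F(ws)$ times the probability of passing from
  $s$ to $v$ without shortening agree up to a constant factor. The walk leaves this regime with probability
  less than $1$, and late departures are rare. Hence the oscillation is at most a fixed fraction of itself
  plus $o(N)$.
\<close>

text \<open>The walk has no global translation invariance: a prefix is inert only while two letters
  stand after it, and a descent exposes it again. The Green distance along the walk therefore does
  not come with the stationarity that Kingman's theorem requires. The proof works with the single
  function \<open>green\<close> on words and its mean increments; the contraction factor of their
  oscillation is \<open>Hit low {} esc\<close>, the probability of a descent from
  \<open>esc\<close>.

  Stopping times do not occur. \<open>Hit T D\<close> is the smallest nonnegative function that is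
  at least 1 on \<open>T\<close> and superharmonic off \<open>T\<close> and \<open>D\<close>, so
  strong Markov arguments become choices of a superharmonic majorant.

  Weak symmetry has three effects: it bounds the increments of \<open>green\<close> in both
  directions, it makes \<open>lang\<close> connected, and it makes reachability through words of a
  minimal length an undirected relation, so that a component can be left only by shortening.\<close>

lemma entropy_sandwich:
  fixes q :: "'b pmf" and F :: "'b \<Rightarrow> real"
  assumes fin: "finite (set_pmf q)" and B: "finite B" "set_pmf q \<subseteq> B"
    and F: "\<And>x. x \<in> B \<Longrightarrow> 0 \<le> F x" "\<And>x. pmf q x \<le> F x"
  shows "measure_pmf.expectation q (\<lambda>x. - ln (F x)) \<le> - measure_pmf.expectation q (\<lambda>x. ln (pmf q x))"
    and "- measure_pmf.expectation q (\<lambda>x. ln (pmf q x)) \<le>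
      measure_pmf.expectation q (\<lambda>x. - ln (F x)) + ln (\<Sum>x\<in>B. F x)"
proof -
  have int: "integrable (measure_pmf q) f" for f :: "'b \<Rightarrow> real"
    by (rule integrable_measure_pmf_finite[OF fin])
  have q: "pmf q x > 0" "F x > 0" if "x \<in> set_pmf q" for x
  proof -
    show "pmf q x > 0" by (rule pmf_positive[OF that])
    then show "F x > 0" using F(2)[of x] by linarith
  qed
  have "measure_pmf.expectation q (\<lambda>x. - ln (F x)) \<le> measure_pmf.expectation q (\<lambda>x. - ln (pmf q x))"
    using q F(2) by (intro integral_mono_AE int) (auto simp: AE_measure_pmf_iff)
  then show "measure_pmf.expectation q (\<lambda>x. - ln (F x)) \<le> - measure_pmf.expectation q (\<lambda>x. ln (pmf q x))"
    by simp
  define Z where "Z = (\<Sum>x\<in>B. F x)"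
  have ex: "measure_pmf.expectation q f = (\<Sum>x\<in>set_pmf q. pmf q x * f x)" for f :: "'b \<Rightarrow> real"
    by (subst integral_measure_pmf[of "set_pmf q"]) (auto simp: fin)
  have one: "(\<Sum>x\<in>set_pmf q. pmf q x) = 1" by (rule sum_pmf_eq_1) (auto simp: fin)
  have "(\<Sum>x\<in>set_pmf q. F x) \<le> Z" unfolding Z_def using B F by (intro sum_mono2) auto
  moreover have "(\<Sum>x\<in>set_pmf q. F x) \<ge> 1" using one F(2) by (metis sum_mono)
  ultimately have Z: "Z > 0" "(\<Sum>x\<in>set_pmf q. F x) / Z \<le> 1" by (auto simp: field_simps)
  \<comment> \<open>Gibbs' inequality, from \<open>ln y \<le> y - 1\<close> at
    \<open>y = F x / (Z * pmf q x)\<close>. \<open>F\<close> is not a probability vector, and its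
    normalisation by \<open>Z\<close> costs the term \<open>ln Z\<close>.\<close>
  have "(\<Sum>x\<in>set_pmf q. pmf q x * (ln (F x) - ln (pmf q x) - ln Z)) \<le> (\<Sum>x\<in>set_pmf q. F x / Z - pmf q x)"
  proof (rule sum_mono)
    fix x assume x: "x \<in> set_pmf q"
    have "ln (F x / (Z * pmf q x)) \<le> F x / (Z * pmf q x) - 1"
      using q[OF x] Z by (intro ln_le_minus_one) auto
    then have "pmf q x * ln (F x / (Z * pmf q x)) \<le> pmf q x * (F x / (Z * pmf q x) - 1)"
      using q[OF x] by (intro mult_left_mono) auto
    moreover have "ln (F x / (Z * pmf q x)) = ln (F x) - ln (pmf q x) - ln Z"
      using q[OF x] Z by (simp add: ln_div ln_mult)
    moreover have "pmf q x * (F x / (Z * pmf q x) - 1) = F x / Z - pmf q x"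
      using q[OF x] Z by (simp add: field_simps)
    ultimately show "pmf q x * (ln (F x) - ln (pmf q x) - ln Z) \<le> F x / Z - pmf q x" by simp
  qed
  also have "\<dots> \<le> 0" using Z one by (simp add: sum_subtractf sum_divide_distrib[symmetric])
  finally have "(\<Sum>x\<in>set_pmf q. pmf q x * ln (F x)) - (\<Sum>x\<in>set_pmf q. pmf q x * ln (pmf q x)) - ln Z \<le> 0"
    using one by (simp add: right_diff_distrib sum_subtractf sum_distrib_right[symmetric])
  then show "- measure_pmf.expectation q (\<lambda>x. ln (pmf q x)) \<le>
      measure_pmf.expectation q (\<lambda>x. - ln (F x)) + ln (\<Sum>x\<in>B. F x)"
    by (simp add: ex Z_def)
qed

section \<open>Markov kernels with finite range\<close>

locale fin_kernel =
  fixes K :: "'s \<Rightarrow> 's pmf"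
  assumes finite_K: "finite (set_pmf (K x))"
begin

section \<open>The transition operator and its iterates\<close>

definition step_op :: "('s \<Rightarrow> real) \<Rightarrow> 's \<Rightarrow> real" where
  "step_op f x = (\<Sum>z\<in>set_pmf (K x). pmf (K x) z * f z)"

lemma step_op_mono: "(\<And>z. z \<in> set_pmf (K x) \<Longrightarrow> f z \<le> g z) \<Longrightarrow> step_op f x \<le> step_op g x"
  unfolding step_op_def by (intro sum_mono mult_left_mono) auto

lemma step_op_const [simp]: "step_op (\<lambda>_. c) x = c"
proof -
  have "(\<Sum>z\<in>set_pmf (K x). pmf (K x) z) = 1"
    by (rule sum_pmf_eq_1) (auto simp: finite_K)
  then show ?thesis unfolding step_op_def by (simp add: sum_distrib_right[symmetric])
qed

lemma step_op_add: "step_op (\<lambda>z. f z + g z) x = step_op f x + step_op g x"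
  unfolding step_op_def by (simp add: algebra_simps sum.distrib)

lemma step_op_diff: "step_op (\<lambda>z. f z - g z) x = step_op f x - step_op g x"
  unfolding step_op_def by (simp add: algebra_simps sum_subtractf)

lemma step_op_cmult: "step_op (\<lambda>z. c * f z) x = c * step_op f x"
  unfolding step_op_def by (simp add: algebra_simps sum_distrib_left)

lemma step_op_sum: "step_op (\<lambda>z. \<Sum>i\<in>I. f i z) x = (\<Sum>i\<in>I. step_op (f i) x)"
  unfolding step_op_def by (simp add: sum_distrib_left) (rule sum.swap)

lemma step_op_nonneg: "(\<And>z. z \<in> set_pmf (K x) \<Longrightarrow> 0 \<le> f z) \<Longrightarrow> 0 \<le> step_op f x"
  using step_op_mono[of x "\<lambda>_. 0" f] by simp

lemma step_op_ge_term:
  assumes "y \<in> set_pmf (K x)" "\<And>z. z \<in> set_pmf (K x) \<Longrightarrow> 0 \<le> f z"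
  shows "pmf (K x) y * f y \<le> step_op f x"
  unfolding step_op_def using assms by (intro member_le_sum) (auto simp: finite_K)

lemma step_op_abs: "\<bar>step_op f x\<bar> \<le> step_op (\<lambda>z. \<bar>f z\<bar>) x"
  unfolding step_op_def by (rule order_trans[OF sum_abs]) (simp add: abs_mult)

lemma step_op_tendsto:
  assumes "\<And>z. z \<in> set_pmf (K x) \<Longrightarrow> (\<lambda>n. f n z) \<longlonglongrightarrow> g z"
  shows "(\<lambda>n. step_op (f n) x) \<longlonglongrightarrow> step_op g x"
  unfolding step_op_def using assms by (intro tendsto_intros) auto

lemma iter_diff: "(step_op ^^ n) (\<lambda>z. f z - g z) x = (step_op ^^ n) f x - (step_op ^^ n) g x"
proof -
  have "(step_op ^^ n) (\<lambda>z. f z - g z) = (\<lambda>x. (step_op ^^ n) f x - (step_op ^^ n) g x)"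
    by (induction n) (auto simp: step_op_diff)
  then show ?thesis by (rule fun_cong)
qed

lemma iter_cmult: "(step_op ^^ n) (\<lambda>z. c * f z) x = c * (step_op ^^ n) f x"
proof -
  have "(step_op ^^ n) (\<lambda>z. c * f z) = (\<lambda>x. c * (step_op ^^ n) f x)"
    by (induction n) (auto simp: step_op_cmult)
  then show ?thesis by (rule fun_cong)
qed

lemma iter_const [simp]: "(step_op ^^ n) (\<lambda>_. c) x = c"
proof -
  have "(step_op ^^ n) (\<lambda>_. c) = (\<lambda>_. c)"
    by (induction n) (auto simp: step_op_const)
  then show ?thesis by (rule fun_cong)
qed

lemma iter_sum: "(step_op ^^ n) (\<lambda>z. \<Sum>i\<in>I. f i z) x = (\<Sum>i\<in>I. (step_op ^^ n) (f i) x)"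
proof -
  have "(step_op ^^ n) (\<lambda>z. \<Sum>i\<in>I. f i z) = (\<lambda>x. \<Sum>i\<in>I. (step_op ^^ n) (f i) x)"
    by (induction n) (auto simp: step_op_sum)
  then show ?thesis by (rule fun_cong)
qed

lemma iter_Suc2: "(step_op ^^ Suc n) f x = (step_op ^^ n) (step_op f) x"
  by (simp add: funpow_swap1)

lemma iter_iter: "(step_op ^^ m) ((step_op ^^ n) f) x = (step_op ^^ (m + n)) f x"
  by (simp add: funpow_add)

definition closed_set :: "'s set \<Rightarrow> bool" where
  "closed_set S \<longleftrightarrow> (\<forall>x\<in>S. set_pmf (K x) \<subseteq> S)"

lemma closed_setD: "closed_set S \<Longrightarrow> x \<in> S \<Longrightarrow> z \<in> set_pmf (K x) \<Longrightarrow> z \<in> S"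
  by (auto simp: closed_set_def)

lemma closed_set_UNIV [simp]: "closed_set UNIV"
  by (simp add: closed_set_def)

lemma iter_mono:
  assumes "closed_set S" "x \<in> S" "\<And>z. z \<in> S \<Longrightarrow> f z \<le> g z"
  shows "(step_op ^^ n) f x \<le> (step_op ^^ n) g x"
  using assms(2)
proof (induction n arbitrary: x)
  case (Suc n)
  then show ?case by (auto intro!: step_op_mono dest: closed_setD[OF assms(1)])
qed (use assms in auto)

lemma iter_abs_diff_le:
  assumes cl: "closed_set S" and x: "x \<in> S" and g: "\<And>z. z \<in> S \<Longrightarrow> \<bar>g z - c\<bar> \<le> e"
  shows "\<bar>(step_op ^^ n) g x - c\<bar> \<le> e"
proof -
  have b: "c - e \<le> g z \<and> g z \<le> c + e" if "z \<in> S" for z using g[OF that] by linarith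
  have "(step_op ^^ n) (\<lambda>_. c - e) x \<le> (step_op ^^ n) g x" "(step_op ^^ n) g x \<le> (step_op ^^ n) (\<lambda>_. c + e) x"
    using b by (simp_all only: iter_mono[OF cl x])
  then show ?thesis unfolding iter_const by linarith
qed

lemma iter_tendsto:
  assumes "\<And>z. (\<lambda>n. f n z) \<longlonglongrightarrow> g z"
  shows "(\<lambda>n. (step_op ^^ k) (f n) x) \<longlonglongrightarrow> (step_op ^^ k) g x"
  by (induction k arbitrary: x) (auto intro: step_op_tendsto assms)

primrec nstep :: "nat \<Rightarrow> 's \<Rightarrow> 's pmf" where
  "nstep 0 x = return_pmf x"
| "nstep (Suc n) x = bind_pmf (K x) (nstep n)"

lemma finite_nstep: "finite (set_pmf (nstep n x))"
  by (induction n arbitrary: x) (auto simp: finite_K)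

lemma expectation_nstep: "measure_pmf.expectation (nstep n x) f = (step_op ^^ n) f x"
proof (induction n arbitrary: x)
  case (Suc n)
  have "measure_pmf.expectation (nstep (Suc n) x) f =
      (\<Sum>a\<in>set_pmf (K x). pmf (K x) a *\<^sub>R measure_pmf.expectation (nstep n a) f)"
    unfolding nstep.simps by (rule pmf_expectation_bind) (auto simp: finite_K finite_nstep)
  then show ?case by (simp add: Suc.IH step_op_def)
qed simp

lemma pmf_nstep: "pmf (nstep n x) y = (step_op ^^ n) (indicator {y}) x"
  by (simp add: expectation_nstep[symmetric] pmf.rep_eq)

lemma prob_nstep: "measure_pmf.prob (nstep n x) A = (step_op ^^ n) (indicator A) x"
  by (simp add: expectation_nstep[symmetric])

lemma nstep_closed: "closed_set S \<Longrightarrow> x \<in> S \<Longrightarrow> set_pmf (nstep n x) \<subseteq> S"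
  by (induction n arbitrary: x) (fastforce dest: closed_setD)+

lemma nstep_add: "nstep (m + n) x = bind_pmf (nstep m x) (nstep n)"
  by (induction m arbitrary: x) (auto simp: bind_return_pmf bind_assoc_pmf intro!: bind_pmf_cong)

text \<open>Only the mass at \<open>y\<close> is looked at; the rest is charged the bound
  \<open>M\<close>. This turns a uniform lower bound on transition probabilities into a strict gain,
  both for oscillations and for visits to a level.\<close>

lemma iter_le_convex:
  assumes cl: "closed_set S" and x: "x \<in> S" and y: "q \<le> pmf (nstep n x) y" "y \<in> S"
    and g: "\<And>z. z \<in> S \<Longrightarrow> g z \<le> M"
  shows "(step_op ^^ n) g x \<le> q * g y + (1 - q) * M"
proof -
  have "(M - g y) * indicator {y} z \<le> M - g z" if "z \<in> S" for z
    using g[OF that] by (auto simp: indicator_def)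
  then have "(step_op ^^ n) (\<lambda>z. (M - g y) * indicator {y} z) x \<le> (step_op ^^ n) (\<lambda>z. M - g z) x"
    by (intro iter_mono[OF cl x])
  then have "(M - g y) * pmf (nstep n x) y \<le> M - (step_op ^^ n) g x"
    by (simp add: iter_cmult iter_diff pmf_nstep)
  moreover have "(M - g y) * q \<le> (M - g y) * pmf (nstep n x) y"
    using g[OF y(2)] y by (intro mult_left_mono) auto
  ultimately show ?thesis by (simp add: algebra_simps)
qed

text \<open>The probability of reaching \<open>T\<close> within \<open>n\<close> steps and before \<open>D\<close>.\<close>

primrec hit :: "nat \<Rightarrow> 's set \<Rightarrow> 's set \<Rightarrow> 's \<Rightarrow> real" where
  "hit 0 T D x = indicator T x"
| "hit (Suc n) T D x = (if x \<in> T then 1 else if x \<in> D then 0 else step_op (hit n T D) x)"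

lemma hit_nonneg: "0 \<le> hit n T D x"
  by (induction n arbitrary: x) (auto intro: step_op_nonneg)

lemma hit_le_1: "hit n T D x \<le> 1"
proof (induction n arbitrary: x)
  case (Suc n)
  have "step_op (hit n T D) x \<le> step_op (\<lambda>_. 1) x" by (rule step_op_mono) (rule Suc.IH)
  then show ?case by auto
qed (auto simp: indicator_def)

lemma hit_Suc_mono: "hit n T D x \<le> hit (Suc n) T D x"
proof (induction n arbitrary: x)
  case 0
  show ?case by (auto simp: indicator_def intro: step_op_nonneg)
next
  case (Suc n)
  have "step_op (hit n T D) x \<le> step_op (hit (Suc n) T D) x" by (rule step_op_mono) (rule Suc.IH)
  then show ?case by auto
qed

lemma hit_mono: "m \<le> n \<Longrightarrow> hit m T D x \<le> hit n T D x"
  by (rule lift_Suc_mono_le[of "\<lambda>n. hit n T D x"]) (auto simp: hit_Suc_mono simp del: hit.simps)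

definition Hit :: "'s set \<Rightarrow> 's set \<Rightarrow> 's \<Rightarrow> real" where
  "Hit T D x = lim (\<lambda>n. hit n T D x)"

lemma hit_tendsto: "(\<lambda>n. hit n T D x) \<longlonglongrightarrow> Hit T D x"
proof -
  have "convergent (\<lambda>n. hit n T D x)"
    by (rule Bseq_mono_convergent)
      (auto intro!: BseqI'[of _ 1] simp: hit_nonneg hit_le_1 hit_mono)
  then show ?thesis by (simp add: Hit_def convergent_LIMSEQ_iff)
qed

lemma hit_le_Hit: "hit n T D x \<le> Hit T D x"
  by (rule incseq_le[OF _ hit_tendsto]) (auto simp: incseq_def hit_mono)

lemma Hit_nonneg: "0 \<le> Hit T D x"
  by (rule order_trans[OF hit_nonneg[of 0] hit_le_Hit])

lemma Hit_le: "(\<And>n. hit n T D x \<le> c) \<Longrightarrow> Hit T D x \<le> c"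
  by (rule LIMSEQ_le_const2[OF hit_tendsto]) auto

lemma Hit_le_1: "Hit T D x \<le> 1"
  by (rule Hit_le) (rule hit_le_1)

lemma Hit_in [simp]: "x \<in> T \<Longrightarrow> Hit T D x = 1"
  by (rule antisym[OF Hit_le_1 order_trans[OF _ hit_le_Hit[of 0]]]) auto

lemma Hit_harmonic:
  assumes "x \<notin> T" "x \<notin> D" shows "step_op (Hit T D) x = Hit T D x"
proof -
  have "(\<lambda>n. hit (Suc n) T D x) \<longlonglongrightarrow> Hit T D x"
    using hit_tendsto by (rule LIMSEQ_Suc)
  moreover have "(\<lambda>n. hit (Suc n) T D x) \<longlonglongrightarrow> step_op (Hit T D) x"
    using assms step_op_tendsto[OF hit_tendsto] by simp
  ultimately show ?thesis by (metis LIMSEQ_unique)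
qed

lemma Hit_superharmonic: "step_op (Hit T {}) x \<le> Hit T {} x"
proof (cases "x \<in> T")
  case True
  have "step_op (Hit T {}) x \<le> step_op (\<lambda>_. 1) x" by (rule step_op_mono) (rule Hit_le_1)
  with True show ?thesis by simp
qed (simp add: Hit_harmonic)

lemma Hit_iter_le: "(step_op ^^ n) (Hit T {}) x \<le> Hit T {} x"
proof (induction n)
  case (Suc n)
  have "(step_op ^^ n) (step_op (Hit T {})) x \<le> (step_op ^^ n) (Hit T {}) x"
    by (rule iter_mono[of UNIV]) (auto simp: Hit_superharmonic)
  then show ?case using Suc iter_Suc2[of n "Hit T {}" x] by simp
qed simp

lemma hit_minimal:
  assumes "\<And>x. 0 \<le> \<Phi> x" "\<And>x. x \<in> T \<Longrightarrow> 1 \<le> \<Phi> x"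
    "\<And>x. x \<notin> T \<Longrightarrow> x \<notin> D \<Longrightarrow> step_op \<Phi> x \<le> \<Phi> x"
  shows "hit n T D x \<le> \<Phi> x"
proof (induction n arbitrary: x)
  case 0
  then show ?case using assms by (auto simp: indicator_def)
next
  case (Suc n)
  have "step_op (hit n T D) x \<le> step_op \<Phi> x" by (rule step_op_mono) (rule Suc.IH)
  then show ?case using assms[of x] by auto
qed

text \<open>The comparison principle that replaces the strong Markov property. On \<open>D\<close>
  the walk is killed, so there a majorant only has to be nonnegative.\<close>

lemma Hit_minimal:
  assumes "\<And>x. 0 \<le> \<Phi> x" "\<And>x. x \<in> T \<Longrightarrow> 1 \<le> \<Phi> x"
    "\<And>x. x \<notin> T \<Longrightarrow> x \<notin> D \<Longrightarrow> step_op \<Phi> x \<le> \<Phi> x"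
  shows "Hit T D x \<le> \<Phi> x"
  by (rule Hit_le) (rule hit_minimal[OF assms])

lemma hit_le_sum_iter: "hit n T D x \<le> (\<Sum>i\<le>n. (step_op ^^ i) (indicator T) x)"
proof (induction n arbitrary: x)
  case (Suc n)
  have nn: "0 \<le> (step_op ^^ i) (indicator T) y" for i y
    using iter_mono[of UNIV y "\<lambda>_. 0" "indicator T" i] by simp
  have "step_op (hit n T D) x \<le> step_op (\<lambda>y. \<Sum>i\<le>n. (step_op ^^ i) (indicator T) y) x"
    by (rule step_op_mono) (rule Suc.IH)
  also have "\<dots> = (\<Sum>i\<le>n. (step_op ^^ Suc i) (indicator T) x)" by (simp add: step_op_sum)
  finally show ?case
    using nn by (auto simp: sum.atMost_Suc_shift simp del: sum.atMost_Suc intro!: sum_nonneg)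
      (metis funpow.simps(2) nn o_apply)+
qed simp

text \<open>By minimality: \<open>Hit {c} D\<close> divided by its value at \<open>b\<close> is at
  least 1 at \<open>b\<close> and superharmonic off \<open>D\<close>. At \<open>x = c\<close>
  harmonicity may fail, and \<open>Hit_le_1\<close> replaces it.\<close>

lemma Hit_trans: "Hit {b} D a * Hit {c} D b \<le> Hit {c} D a"
proof (cases "Hit {c} D b = 0")
  case False
  then have pos: "Hit {c} D b > 0" using Hit_nonneg[of "{c}" D b] by simp
  have "step_op (\<lambda>x. Hit {c} D x / Hit {c} D b) x \<le> Hit {c} D x / Hit {c} D b"
    if "x \<notin> {b}" "x \<notin> D" for x
  proof -
    have "step_op (Hit {c} D) x \<le> Hit {c} D x"
    proof (cases "x = c")
      case True
      have "step_op (Hit {c} D) x \<le> step_op (\<lambda>_. 1) x" by (rule step_op_mono) (rule Hit_le_1)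
      with True show ?thesis by simp
    qed (use that in \<open>simp add: Hit_harmonic\<close>)
    then show ?thesis
      using step_op_cmult[of "1 / Hit {c} D b" "Hit {c} D" x] pos by (simp add: divide_right_mono)
  qed
  then have "Hit {b} D a \<le> Hit {c} D a / Hit {c} D b"
    using pos Hit_nonneg by (intro Hit_minimal) auto
  then show ?thesis using pos by (simp add: field_simps)
qed (simp add: Hit_nonneg)

lemma Hit_step:
  assumes "a \<notin> D"
  shows "pmf (K a) b * Hit T D b \<le> Hit T D a"
proof (cases "a \<in> T")
  case True
  then show ?thesis using Hit_le_1[of T D b] Hit_nonneg[of T D b] pmf_le_1[of "K a" b]
    by (simp add: mult_le_one)
next
  case False
  show ?thesis
  proof (cases "b \<in> set_pmf (K a)")
    case True
    then have "pmf (K a) b * Hit T D b \<le> step_op (Hit T D) a"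
      by (rule step_op_ge_term) (rule Hit_nonneg)
    then show ?thesis using False assms by (simp add: Hit_harmonic)
  qed (simp add: set_pmf_iff Hit_nonneg)
qed

section \<open>Expected numbers of visits and exponential moments\<close>

text \<open>The Green function is the probability of hitting \<open>w\<close> times a geometric
  series in the return probability \<open>step_op (Hit {w} {}) w\<close>. The induction has to carry
  the factor \<open>Hit {w} {} x\<close>: the plain bound \<open>\<gamma>\<close> would grow to
  \<open>1 + \<gamma>\<close> at \<open>x = w\<close>.\<close>

lemma green_bound:
  assumes ret: "step_op (Hit {w} {}) w < 1"
  shows "(\<Sum>i<n. pmf (nstep i x) w) \<le> 1 / (1 - step_op (Hit {w} {}) w)"
proof -
  define \<gamma> where "\<gamma> = 1 / (1 - step_op (Hit {w} {}) w)"
  have \<gamma>: "\<gamma> > 0" "1 + \<gamma> * step_op (Hit {w} {}) w = \<gamma>"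
    using ret by (auto simp: \<gamma>_def field_simps)
  have "(\<Sum>i<n. (step_op ^^ i) (indicator {w}) x) \<le> \<gamma> * Hit {w} {} x"
  proof (induction n arbitrary: x)
    case (Suc n)
    have "(\<Sum>i<Suc n. (step_op ^^ i) (indicator {w}) x) =
        indicator {w} x + step_op (\<lambda>y. \<Sum>i<n. (step_op ^^ i) (indicator {w}) y) x"
      by (simp add: sum.lessThan_Suc_shift step_op_sum del: sum.lessThan_Suc)
    also have "\<dots> \<le> indicator {w} x + \<gamma> * step_op (Hit {w} {}) x"
      using step_op_mono[of x _ "\<lambda>y. \<gamma> * Hit {w} {} y"] Suc.IH by (simp add: step_op_cmult)
    also have "\<dots> \<le> \<gamma> * Hit {w} {} x"
      using \<gamma> Hit_harmonic[of x "{w}" "{}"] by (cases "x = w") auto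
    finally show ?case .
  qed (use \<gamma> Hit_nonneg in auto)
  also have "\<gamma> * Hit {w} {} x \<le> \<gamma>" using \<gamma> Hit_le_1 by (simp add: mult_left_le)
  finally show ?thesis by (simp add: \<gamma>_def pmf_nstep)
qed

lemma iter_lipschitz:
  assumes cl: "closed_set S" and lip: "\<And>x z. x \<in> S \<Longrightarrow> z \<in> set_pmf (K x) \<Longrightarrow> \<bar>f z - f x\<bar> \<le> C"
    and x: "x \<in> S"
  shows "\<bar>step_op ((step_op ^^ n) f) x - (step_op ^^ n) f x\<bar> \<le> C" and "\<bar>(step_op ^^ n) f x - f x\<bar> \<le> C * n"
proof -
  have step: "\<bar>step_op f z - f z\<bar> \<le> C" if "z \<in> S" for z
  proof -
    have "\<bar>step_op (\<lambda>y. f y - f z) z\<bar> \<le> step_op (\<lambda>y. C) z"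
      using lip[OF that] by (intro order_trans[OF step_op_abs] step_op_mono)
    then show ?thesis by (simp add: step_op_diff)
  qed
  have one: "\<bar>step_op ((step_op ^^ m) f) y - (step_op ^^ m) f y\<bar> \<le> C" if y: "y \<in> S" for y m
  proof -
    have e: "step_op ((step_op ^^ m) f) y - (step_op ^^ m) f y = (step_op ^^ m) (\<lambda>z. step_op f z - f z) y"
      using iter_Suc2[of m f y] by (simp add: iter_diff)
    show ?thesis
      unfolding e using iter_abs_diff_le[OF cl y, of "\<lambda>z. step_op f z - f z" 0 C m] step by simp
  qed
  show "\<bar>step_op ((step_op ^^ n) f) x - (step_op ^^ n) f x\<bar> \<le> C" by (rule one[OF x])
  show "\<bar>(step_op ^^ n) f x - f x\<bar> \<le> C * n"
  proof (induction n)
    case (Suc n)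
    then show ?case using one[OF x, of n] by (simp add: algebra_simps)
  qed simp
qed

text \<open>A drift bound at every state takes the place of independence: each step multiplies the
  moment by at most \<open>1 + \<theta> * a + (\<theta> * b)\<^sup>2\<close>, by the quadratic bound
  on \<open>exp\<close> for arguments of modulus at most 1.\<close>

lemma exp_moment:
  assumes cl: "closed_set S" and lip: "\<And>x z. x \<in> S \<Longrightarrow> z \<in> set_pmf (K x) \<Longrightarrow> \<bar>g z - g x\<bar> \<le> b"
    and drift: "\<And>x. x \<in> S \<Longrightarrow> step_op g x - g x \<le> a"
    and \<theta>: "0 \<le> \<theta>" "\<theta> * b \<le> 1" and x: "x \<in> S"
  shows "(step_op ^^ n) (\<lambda>z. exp (\<theta> * g z)) x \<le> exp (\<theta> * g x + n * (\<theta> * a + (\<theta> * b)\<^sup>2))"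
  using x
proof (induction n arbitrary: x)
  case (Suc n)
  have quad: "exp y \<le> 1 + y + y\<^sup>2" if "\<bar>y\<bar> \<le> 1" for y :: real
  proof (cases "0 \<le> y")
    case True
    then show ?thesis using exp_bound[of y] that by auto
  next
    case False
    \<comment> \<open>The product is \<open>1 - y ^ 3\<close>, and \<open>y\<close> is negative
      here.\<close>
    have "1 \<le> (1 + y + y\<^sup>2) * (1 - y)"
      using False by (simp add: algebra_simps power2_eq_square)
        (metis less_eq_real_def linorder_not_less mult_nonneg_nonpos2 not_square_less_zero)
    also have "\<dots> \<le> (1 + y + y\<^sup>2) * exp (- y)"
      using exp_ge_add_one_self[of "- y"] that by (intro mult_left_mono) auto
    finally show ?thesis by (simp add: exp_minus field_simps)
  qed
  let ?c = "\<theta> * a + (\<theta> * b)\<^sup>2"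
  have "(step_op ^^ Suc n) (\<lambda>z. exp (\<theta> * g z)) x \<le> step_op (\<lambda>z. exp (\<theta> * g x + n * ?c) * exp (\<theta> * (g z - g x))) x"
    using Suc.IH closed_setD[OF cl Suc.prems]
    by (auto intro!: step_op_mono simp: mult_exp_exp algebra_simps)
  also have "\<dots> = exp (\<theta> * g x + n * ?c) * step_op (\<lambda>z. exp (\<theta> * (g z - g x))) x" by (rule step_op_cmult)
  also have "step_op (\<lambda>z. exp (\<theta> * (g z - g x))) x \<le> step_op (\<lambda>z. 1 + (\<theta> * b)\<^sup>2 + \<theta> * (g z - g x)) x"
  proof (rule step_op_mono)
    fix z assume z: "z \<in> set_pmf (K x)"
    have "\<bar>\<theta> * (g z - g x)\<bar> \<le> \<theta> * b" using lip[OF Suc.prems z] \<theta> by (simp add: abs_mult mult_left_mono)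
    then show "exp (\<theta> * (g z - g x)) \<le> 1 + (\<theta> * b)\<^sup>2 + \<theta> * (g z - g x)"
      using quad[of "\<theta> * (g z - g x)"] abs_le_square_iff[of "\<theta> * (g z - g x)" "\<theta> * b"] \<theta>(2) by linarith
  qed
  also have "\<dots> = 1 + (\<theta> * b)\<^sup>2 + \<theta> * (step_op g x - g x)"
    by (simp add: step_op_add step_op_cmult step_op_diff)
  also have "\<dots> \<le> 1 + ?c" using drift[OF Suc.prems] \<theta> by (simp add: mult_left_mono)
  also have "\<dots> \<le> exp ?c" by (rule exp_ge_add_one_self)
  finally show ?case by (simp add: mult_exp_exp algebra_simps)
qed simp

text \<open>\<open>(step_op ^^ n) (Hit T {}) x\<close> is the probability of a visit to
  \<open>T\<close> at time \<open>n\<close> or later. Between \<open>n\<close> and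
  \<open>n + m\<close> it drops by at least \<open>\<delta>\<close> times the probability of being
  in \<open>T\<close> at time \<open>n\<close>. Telescoping leaves \<open>m\<close> terms of size at
  most 1.\<close>

lemma expected_visits_bound:
  assumes cl: "closed_set S" and x: "x \<in> S" and \<delta>: "0 \<le> \<delta>"
    and esc: "\<And>y. y \<in> S \<Longrightarrow> y \<in> T \<Longrightarrow> (step_op ^^ m) (Hit T {}) y \<le> 1 - \<delta>"
  shows "\<delta> * (\<Sum>n<N. (step_op ^^ n) (indicator T) x) \<le> m"
proof -
  define \<rho> where "\<rho> n = (step_op ^^ n) (Hit T {}) x" for n
  have "\<delta> * indicator T y \<le> Hit T {} y - (step_op ^^ m) (Hit T {}) y" if "y \<in> S" for y
    using esc[OF that] Hit_iter_le[of m T y] \<delta> by (auto simp: indicator_def)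
  then have "(step_op ^^ n) (\<lambda>y. \<delta> * indicator T y) x \<le>
      (step_op ^^ n) (\<lambda>y. Hit T {} y - (step_op ^^ m) (Hit T {}) y) x" for n
    by (intro iter_mono[OF cl x])
  then have "\<delta> * (step_op ^^ n) (indicator T) x \<le> \<rho> n - \<rho> (n + m)" for n
    by (simp add: iter_cmult iter_diff \<rho>_def funpow_add)
  then have "\<delta> * (\<Sum>n<N. (step_op ^^ n) (indicator T) x) \<le> (\<Sum>n<N. \<rho> n - \<rho> (n + m))"
    unfolding sum_distrib_left by (rule sum_mono)
  also have "\<dots> = (\<Sum>n<m. \<rho> n - \<rho> (n + N))"
  proof -
    have "(\<Sum>n<N. \<rho> n) + (\<Sum>n<m. \<rho> (n + N)) = (\<Sum>n<N + m. \<rho> n)"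
      using sum.nat_group by (simp add: sum_up_index_split add.commute lessThan_atLeast0 sum.atLeastLessThan_concat
        flip: sum.shift_bounds_nat_ivl)
    moreover have "(\<Sum>n<m. \<rho> n) + (\<Sum>n<N. \<rho> (n + m)) = (\<Sum>n<N + m. \<rho> n)"
      by (simp add: lessThan_atLeast0 sum.atLeastLessThan_concat add.commute flip: sum.shift_bounds_nat_ivl)
    ultimately show ?thesis by (simp add: sum_subtractf)
  qed
  also have "\<dots> \<le> (\<Sum>n<m. 1)"
  proof (rule sum_mono)
    fix n
    have "\<rho> n \<le> 1" unfolding \<rho>_def using Hit_iter_le[of n T x] Hit_le_1[of T "{}" x] by linarith
    moreover have "0 \<le> \<rho> (n + N)" unfolding \<rho>_def
      using iter_mono[of UNIV x "\<lambda>_. 0" "Hit T {}" "n + N"] by (simp add: Hit_nonneg)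
    ultimately show "\<rho> n - \<rho> (n + N) \<le> 1" by simp
  qed
  finally show ?thesis by simp
qed

section \<open>From small oscillation to a law of large numbers\<close>

text \<open>Mass \<open>\<delta>\<close> is moved into \<open>G\<close>, where the oscillation is
  smaller; the remaining mass keeps the full oscillation, and \<open>c\<close> pays for the steps
  made. With \<open>d\<close> for supremum minus infimum this gives \<open>d \<le> 2 * c + \<delta>
  * (\<beta> * d + e) + (1 - \<delta>) * d\<close>, which is solved for \<open>d\<close>. The bound
  \<open>B\<close> makes \<open>d\<close> finite.\<close>

lemma oscillation_contraction:
  assumes cl: "closed_set S" and bdd: "\<And>x. x \<in> S \<Longrightarrow> \<bar>U x\<bar> \<le> B"
    and G: "G \<subseteq> S" and \<delta>: "0 < \<delta>" and \<beta>: "\<beta> < 1"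
    and reach: "\<And>x. x \<in> S \<Longrightarrow> \<exists>l\<le>L. \<exists>y\<in>G. \<delta> \<le> pmf (nstep l x) y"
    and contr: "\<And>y y' D. y \<in> G \<Longrightarrow> y' \<in> G \<Longrightarrow> (\<And>x x'. x \<in> S \<Longrightarrow> x' \<in> S \<Longrightarrow> \<bar>U x - U x'\<bar> \<le> D)
      \<Longrightarrow> \<bar>U y - U y'\<bar> \<le> \<beta> * D + e"
    and shift: "\<And>x l. x \<in> S \<Longrightarrow> l \<le> L \<Longrightarrow> \<bar>(step_op ^^ l) U x - U x\<bar> \<le> c"
    and x: "x \<in> S" and x': "x' \<in> S"
  shows "\<bar>U x - U x'\<bar> \<le> (e + 2 * c / \<delta>) / (1 - \<beta>)"
proof -
  define M where "M = (SUP x\<in>S. U x)"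
  define m where "m = (INF x\<in>S. U x)"
  have ne: "S \<noteq> {}" using x by auto
  have ba: "bdd_above (U ` S)" using bdd by (auto simp: bdd_above_def intro!: exI[of _ B]) (meson abs_le_D1 order.trans)
  have bb: "bdd_below (U ` S)" using bdd by (auto simp: bdd_below_def intro!: exI[of _ "- B"]) (meson abs_le_D2 minus_le_iff)
  have M: "U y \<le> M" if "y \<in> S" for y unfolding M_def using ba that by (rule cSUP_upper2) simp
  have m: "m \<le> U y" if "y \<in> S" for y unfolding m_def using bb that by (rule cINF_lower2) simp
  have D: "\<bar>U y - U y'\<bar> \<le> M - m" if "y \<in> S" "y' \<in> S" for y y'
    using M[OF that(1)] M[OF that(2)] m[OF that(1)] m[OF that(2)] by auto
  define V where "V = 2 * c + \<delta> * (\<beta> * (M - m) + e) + (1 - \<delta>) * (M - m)"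
  have V: "U y - U y' \<le> V" if y: "y \<in> S" and y': "y' \<in> S" for y y'
  proof -
    obtain l z where l: "l \<le> L" "z \<in> G" "\<delta> \<le> pmf (nstep l y) z" using reach[OF y] by auto
    obtain l' z' where l': "l' \<le> L" "z' \<in> G" "\<delta> \<le> pmf (nstep l' y') z'" using reach[OF y'] by auto
    have zS: "z \<in> S" "z' \<in> S" using l l' G by auto
    have "(step_op ^^ l) U y \<le> \<delta> * U z + (1 - \<delta>) * M"
      by (rule iter_le_convex[OF cl y l(3) zS(1)]) (rule M)
    then have 1: "U y \<le> c + \<delta> * U z + (1 - \<delta>) * M" using shift[OF y l(1)] by linarith
    have "(step_op ^^ l') (\<lambda>x. (-1) * U x) y' \<le> \<delta> * (- 1 * U z') + (1 - \<delta>) * (- m)"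
      by (rule iter_le_convex[OF cl y' l'(3) zS(2)]) (use m in auto)
    then have 2: "- U y' \<le> c - \<delta> * U z' - (1 - \<delta>) * m"
      using shift[OF y' l'(1)] unfolding iter_cmult by (simp add: algebra_simps abs_le_iff)
    have "\<delta> * (U z - U z') \<le> \<delta> * (\<beta> * (M - m) + e)"
      using contr[OF l(2) l'(2) D] \<delta> by (intro mult_left_mono) (auto simp: abs_le_iff)
    with 1 2 show ?thesis unfolding V_def by (simp add: algebra_simps)
  qed
  have "M \<le> V + U y'" if "y' \<in> S" for y'
    unfolding M_def using V[OF _ that] ne by (intro cSUP_least) (auto simp: algebra_simps)
  then have "M - V \<le> m" unfolding m_def using ne by (intro cINF_greatest) (auto simp: algebra_simps)
  then have "\<delta> * ((1 - \<beta>) * (M - m)) \<le> \<delta> * (e + 2 * c / \<delta>)"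
    using \<delta> unfolding V_def by (simp add: algebra_simps)
  then have "(1 - \<beta>) * (M - m) \<le> e + 2 * c / \<delta>"
    using \<delta> by (rule mult_left_le_imp_le)
  then have "M - m \<le> (e + 2 * c / \<delta>) / (1 - \<beta>)"
    using \<beta> by (simp add: pos_le_divide_eq mult.commute)
  then show ?thesis using D[OF x x'] by simp
qed

text \<open>A Chernoff bound. The exponential moment is taken of \<open>g\<close>, whose drift is
  controlled at every state, and transferred to \<open>f\<close>, whose own drift is not, for a
  factor \<open>exp (\<theta> * B)\<close>.\<close>

lemma summable_upper_tail:
  fixes f g :: "'s \<Rightarrow> real" and a b B \<eta> :: real
  assumes cl: "closed_set S" and lip: "\<And>x z. x \<in> S \<Longrightarrow> z \<in> set_pmf (K x) \<Longrightarrow> \<bar>g z - g x\<bar> \<le> b" and b: "1 \<le> b"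
    and drift: "\<And>x. x \<in> S \<Longrightarrow> step_op g x - g x \<le> a"
    and x: "x \<in> S" and fg: "\<And>x. x \<in> S \<Longrightarrow> f x \<le> g x + B" and \<eta>: "0 < \<eta>" "\<eta> \<le> 1"
  shows "summable (\<lambda>n. measure_pmf.prob (nstep n x) {z. n * (a + \<eta>) \<le> f z})"
proof -
  \<comment> \<open>The minimiser of \<open>(\<theta> * b)\<^sup>2 - \<theta> * \<eta>\<close>. The
    bounds \<open>1 \<le> b\<close> and \<open>\<eta> \<le> 1\<close> ensure
    \<open>\<theta> * b \<le> 1\<close>.\<close>
  define \<theta> where "\<theta> = \<eta> / (2 * b\<^sup>2)"
  have bb: "b \<le> b\<^sup>2" using b by (simp add: self_le_power)
  have \<theta>: "0 \<le> \<theta>" "\<theta> * b \<le> 1" "(\<theta> * b)\<^sup>2 - \<theta> * \<eta> = - (\<eta>\<^sup>2 / (4 * b\<^sup>2))"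
    using b \<eta> bb by (auto simp: \<theta>_def field_simps power2_eq_square)
  define C where "C = exp (\<theta> * (g x + B))"
  have le: "measure_pmf.prob (nstep n x) {z. n * (a + \<eta>) \<le> f z} \<le> C * exp (- (\<eta>\<^sup>2 / (4 * b\<^sup>2))) ^ n" for n
  proof -
    have "measure_pmf.prob (nstep n x) {z. n * (a + \<eta>) \<le> f z} \<le>
        (step_op ^^ n) (\<lambda>z. exp (\<theta> * (B - n * (a + \<eta>))) * exp (\<theta> * g z)) x"
      unfolding prob_nstep
    proof (rule iter_mono[OF cl x])
      fix z assume z: "z \<in> S"
      show "indicator {z. n * (a + \<eta>) \<le> f z} z \<le> exp (\<theta> * (B - n * (a + \<eta>))) * exp (\<theta> * g z)"
      proof (cases "n * (a + \<eta>) \<le> f z")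
        case True
        then have "0 \<le> \<theta> * (B - n * (a + \<eta>) + g z)" using fg[OF z] \<theta> by (intro mult_nonneg_nonneg) auto
        then show ?thesis using True by (simp add: mult_exp_exp algebra_simps)
      qed simp
    qed
    also have "\<dots> = exp (\<theta> * (B - n * (a + \<eta>))) * (step_op ^^ n) (\<lambda>z. exp (\<theta> * g z)) x" by (rule iter_cmult)
    also have "\<dots> \<le> exp (\<theta> * (B - n * (a + \<eta>))) * exp (\<theta> * g x + n * (\<theta> * a + (\<theta> * b)\<^sup>2))"
      by (intro mult_left_mono exp_moment[OF cl lip drift \<theta>(1,2) x]) auto
    also have "\<dots> = C * exp (n * ((\<theta> * b)\<^sup>2 - \<theta> * \<eta>))"
      by (simp add: C_def mult_exp_exp algebra_simps)
    also have "\<dots> = C * exp (- (\<eta>\<^sup>2 / (4 * b\<^sup>2))) ^ n"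
      unfolding \<theta>(3) exp_of_nat_mult ..
    finally show ?thesis .
  qed
  have "0 < \<eta>\<^sup>2 / (4 * b\<^sup>2)" using b \<eta> by auto
  then have "summable (\<lambda>n. C * exp (- (\<eta>\<^sup>2 / (4 * b\<^sup>2))) ^ n)"
    by (intro summable_mult summable_geometric) auto
  then show ?thesis by (rule summable_comparison_test[rotated]) (use le in \<open>auto simp: measure_nonneg\<close>)
qed

theorem strong_law_of_small_oscillation:
  fixes f :: "'s \<Rightarrow> real"
  assumes cl: "closed_set S" and lip: "\<And>x z. x \<in> S \<Longrightarrow> z \<in> set_pmf (K x) \<Longrightarrow> \<bar>f z - f x\<bar> \<le> C"
    and x0: "x0 \<in> S"
    and osc: "\<And>\<epsilon>. 0 < \<epsilon> \<Longrightarrow> \<exists>N>0. \<forall>x\<in>S. \<forall>y\<in>S.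
      \<bar>((step_op ^^ N) f x - f x) - ((step_op ^^ N) f y - f y)\<bar> \<le> \<epsilon> * real N"
  obtains l :: real where "(\<lambda>n. (step_op ^^ n) f x0 / real n) \<longlonglongrightarrow> l"
    and "\<And>\<epsilon>. 0 < \<epsilon> \<Longrightarrow> summable (\<lambda>n. measure_pmf.prob (nstep n x0) {z. real n * \<epsilon> \<le> \<bar>f z - real n * l\<bar>})"
proof -
  have C: "0 \<le> C" using lip[OF x0] set_pmf_not_empty[of "K x0"] by force
  have corr: "\<exists>\<psi> c b B. (\<forall>x\<in>S. \<bar>\<psi> x - f x\<bar> \<le> B) \<and> 1 \<le> b \<and>
      (\<forall>x\<in>S. \<forall>z\<in>set_pmf (K x). \<bar>\<psi> z - \<psi> x\<bar> \<le> b) \<and> (\<forall>x\<in>S. \<bar>step_op \<psi> x - \<psi> x - c\<bar> \<le> \<epsilon>)"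
    if \<epsilon>: "0 < \<epsilon>" for \<epsilon>
  proof -
    obtain N where N: "N > 0" and o: "\<And>x y. x \<in> S \<Longrightarrow> y \<in> S \<Longrightarrow>
      \<bar>((step_op ^^ N) f x - f x) - ((step_op ^^ N) f y - f y)\<bar> \<le> \<epsilon> * real N" using osc[OF \<epsilon>] by blast
    define \<psi> where "\<psi> x = 1 / N * (\<Sum>i<N. (step_op ^^ i) f x)" for x
    define c where "c = ((step_op ^^ N) f x0 - f x0) / N"
    have near: "\<bar>\<psi> x - f x\<bar> \<le> C * N" if x: "x \<in> S" for x
    proof -
      have "\<bar>\<Sum>i<N. ((step_op ^^ i) f x - f x)\<bar> \<le> (\<Sum>i<N. C * N)"
      proof (rule order_trans[OF sum_abs sum_mono])
        fix i assume "i \<in> {..<N}"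
        then have "C * i \<le> C * N" using C by (intro mult_left_mono) auto
        then show "\<bar>(step_op ^^ i) f x - f x\<bar> \<le> C * N" using iter_lipschitz(2)[where f = f and n = i, OF cl lip x] by linarith
      qed
      moreover have "N * (\<psi> x - f x) = (\<Sum>i<N. ((step_op ^^ i) f x - f x))"
        using N by (simp add: \<psi>_def sum_subtractf algebra_simps)
      ultimately have "\<bar>N * (\<psi> x - f x)\<bar> \<le> N * (C * N)" by simp
      then show ?thesis using N by (simp add: abs_mult)
    qed
    \<comment> \<open>\<open>near\<close> at both ends and the Lipschitz bound in between; the
      summand 1 secures \<open>1 \<le> b\<close>.\<close>
    have "\<bar>\<psi> z - \<psi> x\<bar> \<le> 2 * C * N + C + 1" if x: "x \<in> S" and z: "z \<in> set_pmf (K x)" for x z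
      using near[OF x] near[OF closed_setD[OF cl x z]] lip[OF x z] by linarith
    moreover have "\<bar>step_op \<psi> x - \<psi> x - c\<bar> \<le> \<epsilon>" if x: "x \<in> S" for x
    proof -
      have "step_op \<psi> x = 1 / N * (\<Sum>i<N. (step_op ^^ Suc i) f x)"
        unfolding \<psi>_def step_op_cmult step_op_sum by simp
      moreover have "(\<Sum>i<N. (step_op ^^ Suc i) f x) = (\<Sum>i<N. (step_op ^^ i) f x) + (step_op ^^ N) f x - f x"
        using sum.lessThan_Suc_shift[of "\<lambda>i. (step_op ^^ i) f x" N] by simp
      ultimately have e: "step_op \<psi> x - \<psi> x - c = (((step_op ^^ N) f x - f x) - ((step_op ^^ N) f x0 - f x0)) / N"
        unfolding \<psi>_def c_def by (simp add: diff_divide_distrib add_divide_distrib)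
      show ?thesis unfolding e using o[OF x x0] N by (simp add: pos_divide_le_eq)
    qed
    ultimately show ?thesis using near C
      by (intro exI[of _ \<psi>] exI[of _ c] exI[of _ "2 * C * N + C + 1"] exI[of _ "C * N"]) auto
  qed
  define mean where "mean n = (step_op ^^ n) f x0 / real n" for n
  have mean_close: "eventually (\<lambda>n. \<bar>mean n - c\<bar> \<le> 2 * \<epsilon>) sequentially"
    if \<epsilon>: "0 < \<epsilon>" and near: "\<And>x. x \<in> S \<Longrightarrow> \<bar>\<psi> x - f x\<bar> \<le> B"
      and drift: "\<And>x. x \<in> S \<Longrightarrow> \<bar>step_op \<psi> x - \<psi> x - c\<bar> \<le> \<epsilon>" for \<epsilon> \<psi> B c
  proof -
    have "\<bar>(step_op ^^ n) \<psi> x0 - \<psi> x0 - n * c\<bar> \<le> n * \<epsilon>" for n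
    proof (induction n)
      case (Suc n)
      have e: "(step_op ^^ Suc n) \<psi> x0 - (step_op ^^ n) \<psi> x0 = (step_op ^^ n) (\<lambda>x. step_op \<psi> x - \<psi> x) x0"
        using iter_Suc2[of n \<psi> x0] by (simp add: iter_diff)
      have "\<bar>(step_op ^^ Suc n) \<psi> x0 - (step_op ^^ n) \<psi> x0 - c\<bar> \<le> \<epsilon>"
        unfolding e by (rule iter_abs_diff_le[OF cl x0]) (rule drift)
      moreover have "real (Suc n) * c = n * c + c" "real (Suc n) * \<epsilon> = n * \<epsilon> + \<epsilon>"
        by (simp_all add: algebra_simps)
      ultimately show ?case using Suc by linarith
    qed simp
    moreover have "\<bar>(step_op ^^ n) \<psi> x0 - (step_op ^^ n) f x0\<bar> \<le> B" for n
      using iter_abs_diff_le[OF cl x0, of "\<lambda>x. \<psi> x - f x" 0 B n] near by (simp add: iter_diff)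
    ultimately have *: "\<bar>(step_op ^^ n) f x0 - n * c\<bar> \<le> n * \<epsilon> + (\<bar>\<psi> x0\<bar> + B)" for n
      using abs_ge_self[of "\<psi> x0"] abs_ge_minus_self[of "\<psi> x0"]
      by (smt (verit, best))
    have "eventually (\<lambda>n. (\<bar>\<psi> x0\<bar> + B) / \<epsilon> \<le> real n \<and> 0 < n) sequentially"
      using filterlim_real_sequentially by (intro eventually_conj) (auto simp: filterlim_at_top eventually_gt_at_top)
    then show ?thesis
    proof eventually_elim
      case (elim n)
      then have "\<bar>\<psi> x0\<bar> + B \<le> n * \<epsilon>" using \<epsilon> by (simp add: field_simps)
      then have "\<bar>(step_op ^^ n) f x0 - n * c\<bar> \<le> n * (2 * \<epsilon>)" using *[of n] by linarith
      moreover have "(step_op ^^ n) f x0 - n * c = n * (mean n - c)" using elim by (simp add: mean_def field_simps)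
      ultimately show ?case using elim by (simp add: abs_mult)
    qed
  qed
  \<comment> \<open>The drift constant \<open>c\<close> changes with the accuracy, so no candidate
    for the limit is at hand. For every \<open>\<epsilon>\<close> the means eventually stay within
    \<open>2 * \<epsilon>\<close> of some \<open>c\<close>, which makes them a Cauchy
    sequence.\<close>
  have "Cauchy mean"
  proof (rule metric_CauchyI)
    fix e :: real assume e: "0 < e"
    then obtain \<psi> c b B where "\<forall>x\<in>S. \<bar>\<psi> x - f x\<bar> \<le> B" "\<forall>x\<in>S. \<bar>step_op \<psi> x - \<psi> x - c\<bar> \<le> e / 8"
      using corr[of "e / 8"] by auto
    then have "eventually (\<lambda>n. \<bar>mean n - c\<bar> \<le> 2 * (e / 8)) sequentially"
      using e by (intro mean_close[of _ \<psi> B]) auto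
    then obtain M where M: "\<And>n. n \<ge> M \<Longrightarrow> \<bar>mean n - c\<bar> \<le> 2 * (e / 8)"
      by (auto simp: eventually_sequentially)
    show "\<exists>M. \<forall>m\<ge>M. \<forall>n\<ge>M. dist (mean m) (mean n) < e"
    proof (intro exI allI impI)
      fix m n assume "m \<ge> M" "n \<ge> M"
      then show "dist (mean m) (mean n) < e"
        using M[of m] M[of n] e unfolding dist_real_def by linarith
    qed
  qed
  then obtain l where l: "mean \<longlonglongrightarrow> l" using Cauchy_convergent_iff convergent_def by blast
  have "summable (\<lambda>n. measure_pmf.prob (nstep n x0) {z. real n * e \<le> \<bar>f z - real n * l\<bar>})" if e: "0 < e" for e :: real
  proof -
    \<comment> \<open>Of the four \<open>\<eta>\<close>, two bound the distance from
      \<open>l\<close> to \<open>c\<close>, one is the error of the drift, and one is the slack in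
      \<open>summable_upper_tail\<close>.\<close>
    define \<eta> where "\<eta> = min 1 (e / 4)"
    have \<eta>: "0 < \<eta>" "\<eta> \<le> 1" "4 * \<eta> \<le> e" using e by (auto simp: \<eta>_def)
    obtain \<psi> c b B where \<psi>: "\<And>x. x \<in> S \<Longrightarrow> \<bar>\<psi> x - f x\<bar> \<le> B" "1 \<le> b"
        "\<And>x z. x \<in> S \<Longrightarrow> z \<in> set_pmf (K x) \<Longrightarrow> \<bar>\<psi> z - \<psi> x\<bar> \<le> b"
        "\<And>x. x \<in> S \<Longrightarrow> \<bar>step_op \<psi> x - \<psi> x - c\<bar> \<le> \<eta>"
      using corr[OF \<eta>(1)] by metis
    have "eventually (\<lambda>n. \<bar>mean n - c\<bar> \<le> 2 * \<eta>) sequentially"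
      by (rule mean_close[OF \<eta>(1) \<psi>(1) \<psi>(4)])
    moreover have "(\<lambda>n. \<bar>mean n - c\<bar>) \<longlonglongrightarrow> \<bar>l - c\<bar>" by (intro tendsto_intros l)
    ultimately have lc: "\<bar>l - c\<bar> \<le> 2 * \<eta>"
      using tendsto_upperbound trivial_limit_sequentially by blast
    have up: "summable (\<lambda>n. measure_pmf.prob (nstep n x0) {z. n * ((c + \<eta>) + \<eta>) \<le> f z})"
    proof (rule summable_upper_tail[OF cl \<psi>(3) \<psi>(2) _ x0 _ \<eta>(1,2), where B = B])
      fix x assume x: "x \<in> S"
      show "step_op \<psi> x - \<psi> x \<le> c + \<eta>" using \<psi>(4)[OF x] by linarith
      show "f x \<le> \<psi> x + B" using \<psi>(1)[OF x] by linarith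
    qed
    have lo: "summable (\<lambda>n. measure_pmf.prob (nstep n x0) {z. n * ((- c + \<eta>) + \<eta>) \<le> - f z})"
    proof (rule summable_upper_tail[OF cl _ \<psi>(2) _ x0 _ \<eta>(1,2), where B = B and g = "\<lambda>x. - \<psi> x"])
      fix x assume x: "x \<in> S"
      have "step_op (\<lambda>x. - \<psi> x) x = - step_op \<psi> x" using step_op_cmult[of "-1" \<psi> x] by simp
      then show "step_op (\<lambda>x. - \<psi> x) x - - \<psi> x \<le> - c + \<eta>" using \<psi>(4)[OF x] by linarith
      show "- f x \<le> - \<psi> x + B" using \<psi>(1)[OF x] by linarith
      fix z assume "z \<in> set_pmf (K x)"
      then show "\<bar>- \<psi> z - - \<psi> x\<bar> \<le> b" using \<psi>(3)[OF x, of z] by (simp add: abs_minus_commute)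
    qed
    show ?thesis
    proof (rule summable_comparison_test[rotated, OF summable_add[OF up lo]], intro exI[of _ 0] allI impI)
      fix n :: nat
      have "{z. real n * e \<le> \<bar>f z - real n * l\<bar>} \<subseteq> {z. n * ((c + \<eta>) + \<eta>) \<le> f z} \<union> {z. n * ((- c + \<eta>) + \<eta>) \<le> - f z}"
      proof
        fix z assume "z \<in> {z. real n * e \<le> \<bar>f z - real n * l\<bar>}"
        then have "n * (4 * \<eta>) \<le> \<bar>f z - real n * l\<bar>"
          using \<eta>(3) mult_left_mono[of "4 * \<eta>" e "real n"] by auto
        moreover have "\<bar>n * l - n * c\<bar> \<le> n * (2 * \<eta>)"
          using lc by (simp add: right_diff_distrib[symmetric] abs_mult mult_left_mono)
        ultimately show "z \<in> {z. n * ((c + \<eta>) + \<eta>) \<le> f z} \<union> {z. n * ((- c + \<eta>) + \<eta>) \<le> - f z}"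
          by (simp add: algebra_simps) linarith
      qed
      then have "measure_pmf.prob (nstep n x0) {z. real n * e \<le> \<bar>f z - real n * l\<bar>} \<le>
          measure_pmf.prob (nstep n x0) ({z. n * ((c + \<eta>) + \<eta>) \<le> f z} \<union> {z. n * ((- c + \<eta>) + \<eta>) \<le> - f z})"
        by (intro measure_pmf.finite_measure_mono) auto
      also have "\<dots> \<le> measure_pmf.prob (nstep n x0) {z. n * ((c + \<eta>) + \<eta>) \<le> f z} +
          measure_pmf.prob (nstep n x0) {z. n * ((- c + \<eta>) + \<eta>) \<le> - f z}"
        by (rule measure_Un_le) auto
      finally show "norm (measure_pmf.prob (nstep n x0) {z. real n * e \<le> \<bar>f z - real n * l\<bar>}) \<le>
          measure_pmf.prob (nstep n x0) {z. n * ((c + \<eta>) + \<eta>) \<le> f z} +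
          measure_pmf.prob (nstep n x0) {z. n * ((- c + \<eta>) + \<eta>) \<le> - f z}"
        by simp
    qed
  qed
  note tails = this
  have "(\<lambda>n. (step_op ^^ n) f x0 / real n) \<longlonglongrightarrow> l"
    using l unfolding mean_def[abs_def] .
  then show ?thesis by (rule that) (rule tails)
qed

end

section \<open>Walks on words\<close>

locale word_kernel =
  fixes p :: "'a::finite list \<Rightarrow> 'a list pmf"
  assumes local: "local_transitions p"
begin

abbreviation K :: "'a list \<Rightarrow> 'a list pmf" where "K \<equiv> transition_kernel p"

lemma set_p:
  assumes "length s \<le> 2" "b \<in> set_pmf (p s)"
  shows "length b \<le> length s + 1" "length s \<le> length b + 1"
proof -
  have 2: "length b \<in> {1, 2, 3}" if "b \<in> set_pmf (p [a1, a2])" for a1 a2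
    using local that unfolding local_transitions_def by blast
  have 1: "length b \<in> {0, 1, 2}" if "b \<in> set_pmf (p [a1])" for a1
    using local that unfolding local_transitions_def by blast
  have 0: "length b \<in> {0, 1}" if "b \<in> set_pmf (p [])"
    using local that unfolding local_transitions_def by blast
  have "length b \<le> length s + 1 \<and> length s \<le> length b + 1"
  proof (cases s)
    case Nil
    then show ?thesis using 0 assms(2) by auto
  next
    case (Cons a1 t)
    show ?thesis
    proof (cases t)
      case Nil
      then show ?thesis using 1[of a1] assms(2) Cons by auto
    next
      case (Cons a2 u)
      then show ?thesis using 2[of a1 a2] assms \<open>s = a1 # t\<close> by auto
    qed
  qed
  then show "length b \<le> length s + 1" "length s \<le> length b + 1" by auto
qed

lemma finite_words: "finite {x :: 'a list. length x \<le> n}"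
  using finite_lists_length_le[of "UNIV :: 'a set" n] by simp

lemma finite_words_eq: "finite {x :: 'a list. length x = n}"
  by (rule finite_subset[OF _ finite_words[of n]]) auto

lemma finite_p: "length s \<le> 2 \<Longrightarrow> finite (set_pmf (p s))"
  by (rule finite_subset[OF _ finite_words[of "length s + 1"]]) (auto dest: set_p)

sublocale fin_kernel K
  by unfold_locales (simp add: transition_kernel_def finite_p)

text \<open>A step rewrites only the last two letters. All comparisons between different prefixes
  rest on this; note that the step itself may leave a single letter after \<open>w\<close>.\<close>

lemma K_append: "2 \<le> length z \<Longrightarrow> K (w @ z) = map_pmf ((@) w) (K z)"
  by (simp add: transition_kernel_def map_pmf_comp)

lemma K_length:
  assumes "z \<in> set_pmf (K x)" shows "length z \<le> length x + 1" "length x \<le> length z + 1"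
proof -
  obtain b where "b \<in> set_pmf (p (drop (length x - 2) x))" "z = take (length x - 2) x @ b"
    using assms by (auto simp: transition_kernel_def)
  then show "length z \<le> length x + 1" "length x \<le> length z + 1"
    using set_p[of "drop (length x - 2) x" b] by (cases "length x \<le> 2"; auto)+
qed

lemma step_op_eq_expectation: "step_op f x = measure_pmf.expectation (K x) f"
  by (simp add: step_op_def integral_measure_pmf[of "set_pmf (K x)"] finite_K)

lemma step_op_append: "2 \<le> length z \<Longrightarrow> step_op f (w @ z) = step_op (\<lambda>z'. f (w @ z')) z"
  by (simp add: step_op_eq_expectation K_append)

lemma min_prob: "\<exists>\<epsilon>>0. \<epsilon> \<le> 1 \<and> (\<forall>x. \<forall>z\<in>set_pmf (K x). \<epsilon> \<le> pmf (K x) z)"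
proof -
  define A where "A = (\<Union>s\<in>{s. length s \<le> 2}. pmf (p s) ` set_pmf (p s))"
  have fin: "finite A" unfolding A_def by (intro finite_UN_I finite_words) (auto intro: finite_p)
  have ne: "A \<noteq> {}" unfolding A_def using set_pmf_not_empty[of "p []"] by force
  have pos: "0 < a \<and> a \<le> 1" if "a \<in> A" for a using that by (auto simp: A_def pmf_positive pmf_le_1)
  have "Min A \<in> A" using fin ne by (rule Min_in)
  show ?thesis
  proof (intro exI[of _ "Min A"] conjI allI ballI)
    fix x z assume "z \<in> set_pmf (K x)"
    then obtain b where b: "b \<in> set_pmf (p (drop (length x - 2) x))" "z = take (length x - 2) x @ b"
      by (auto simp: transition_kernel_def)
    then have "pmf (K x) z = pmf (p (drop (length x - 2) x)) b"
      by (simp add: transition_kernel_def pmf_map_inj' inj_def)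
    also have "\<dots> \<in> A" unfolding A_def using b by (intro UN_I[of "drop (length x - 2) x"]) auto
    finally show "Min A \<le> pmf (K x) z" using fin by simp
  qed (use pos \<open>Min A \<in> A\<close> in auto)
qed

section \<open>Reachability without shortening\<close>

text \<open>A path in \<open>up (length w + 2)\<close> that starts with \<open>w\<close> never
  alters \<open>w\<close>, so suffix-irreducibility becomes reachability in this graph. The empty
  path carries no length condition, hence the length hypothesis in \<open>up_length\<close>.\<close>

definition up :: "nat \<Rightarrow> ('a list \<times> 'a list) set" where
  "up m = {(x, y). m \<le> length x \<and> m \<le> length y \<and> y \<in> set_pmf (K x)}"

lemma up_append: "(z, z') \<in> up 2 \<Longrightarrow> (w @ z, w @ z') \<in> up (length w + 2)"
  by (auto simp: up_def K_append)

lemma up_relpow_append: "(z, z') \<in> up 2 ^^ n \<Longrightarrow> (w @ z, w @ z') \<in> up (length w + 2) ^^ n"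
proof (induction n arbitrary: z')
  case (Suc n)
  from Suc.prems obtain y where "(z, y) \<in> up 2 ^^ n" "(y, z') \<in> up 2" by (rule relpow_Suc_E)
  then show ?case by (rule relpow_Suc_I[OF Suc.IH up_append])
qed simp

lemma up_antimono: "m \<le> n \<Longrightarrow> up n \<subseteq> up m"
  by (auto simp: up_def)

lemma up_rtrancl_append: "(z, z') \<in> (up 2)\<^sup>* \<Longrightarrow> (w @ z, w @ z') \<in> (up (length w + 2))\<^sup>*"
proof (induction rule: rtrancl_induct)
  case (step y z')
  then show ?case by (meson rtrancl.rtrancl_into_rtrancl up_append)
qed simp

lemma up_rtrancl_prefix:
  assumes "(w @ z, y) \<in> (up (length w + 2))\<^sup>*" "2 \<le> length z"
  shows "\<exists>z'. y = w @ z' \<and> 2 \<le> length z' \<and> (z, z') \<in> (up 2)\<^sup>*"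
  using assms
proof (induction rule: rtrancl_induct)
  case (step y y')
  then obtain z' where z': "y = w @ z'" "2 \<le> length z'" "(z, z') \<in> (up 2)\<^sup>*" by auto
  with step(2) obtain z'' where z'': "y' = w @ z''" "z'' \<in> set_pmf (K z')" "2 \<le> length z''"
    by (auto simp: up_def K_append)
  then have "(z', z'') \<in> up 2" using z' by (auto simp: up_def)
  then show ?case using z' z'' by (auto intro!: exI[of _ z''] rtrancl.rtrancl_into_rtrancl[of z z'])
qed auto

lemma up_length: "(x, y) \<in> (up m)\<^sup>* \<Longrightarrow> m \<le> length y \<Longrightarrow> m \<le> length x"
  by (erule converse_rtranclE) (auto simp: up_def)

lemma relpow_up_nstep: "(x, y) \<in> up m ^^ n \<Longrightarrow> y \<in> set_pmf (nstep n x)"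
proof (induction n arbitrary: x)
  case (Suc n)
  from Suc.prems obtain z where "(x, z) \<in> up m" "(z, y) \<in> up m ^^ n"
    by (meson relpow_Suc_D2)
  then show ?case using Suc.IH by (auto simp: up_def)
qed simp

lemma nstep_up: "y \<in> set_pmf (nstep n x) \<Longrightarrow> (x, y) \<in> (up 0)\<^sup>*"
proof (induction n arbitrary: x)
  case (Suc n)
  then obtain z where "z \<in> set_pmf (K x)" "(z, y) \<in> (up 0)\<^sup>*" by auto
  then show ?case by (auto simp: up_def intro: converse_rtrancl_into_rtrancl)
qed simp

lemma pmf_nstep_ge:
  assumes \<epsilon>: "\<And>x z. z \<in> set_pmf (K x) \<Longrightarrow> \<epsilon> \<le> pmf (K x) z" "0 \<le> \<epsilon>"
  shows "y \<in> set_pmf (nstep n x) \<Longrightarrow> \<epsilon> ^ n \<le> pmf (nstep n x) y"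
proof (induction n arbitrary: x)
  case (Suc n)
  then obtain z where z: "z \<in> set_pmf (K x)" "y \<in> set_pmf (nstep n z)" by auto
  have "\<epsilon> * \<epsilon> ^ n \<le> pmf (K x) z * pmf (nstep n z) y"
    using \<epsilon> z Suc.IH by (intro mult_mono) auto
  also have "\<dots> \<le> step_op (\<lambda>z. pmf (nstep n z) y) x" by (rule step_op_ge_term) (use z in auto)
  also have "\<dots> = pmf (nstep (Suc n) x) y" by (simp add: pmf_nstep del: nstep.simps)
  finally show ?case by simp
qed simp

section \<open>Hitting probabilities before a descent\<close>

text \<open>For the part of a word after an inert prefix, being in \<open>low\<close> means that the
  next step can rewrite the end of the prefix.\<close>

abbreviation low :: "'a list set" where "low \<equiv> {x. length x < 2}"

lemma Hit_pos:
  assumes "(x, v) \<in> (up 2)\<^sup>*" shows "0 < Hit {v} low x"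
  using assms
proof (induction rule: converse_rtrancl_induct)
  case (step y z)
  then have "0 < pmf (K y) z * Hit {v} low z" by (auto simp: up_def pmf_positive)
  also have "\<dots> \<le> Hit {v} low y" using step by (intro Hit_step) (auto simp: up_def)
  finally show ?case .
qed simp

text \<open>Until \<open>low\<close> is entered, the walks from \<open>x\<close> and from
  \<open>w @ x\<close> make the same moves. The second may also come back after a descent, so only
  an inequality results.\<close>

lemma Hit_translate: "Hit {v} low x \<le> Hit {w @ v} {} (w @ x)"
proof (rule Hit_minimal)
  fix y assume "y \<notin> {v}" "y \<notin> low"
  then show "step_op (\<lambda>x. Hit {w @ v} {} (w @ x)) y \<le> Hit {w @ v} {} (w @ y)"
    using Hit_superharmonic[of "{w @ v}" "w @ y"] by (simp add: step_op_append)
qed (auto simp: Hit_nonneg)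

text \<open>The words of \<open>T\<close> are too short to be \<open>w\<close> followed by two
  letters, so the part after \<open>w\<close> must fall into \<open>low\<close> first. The majorant
  is 1 from then on, and superharmonicity needs an argument only above \<open>w\<close>.\<close>

lemma Hit_low_translate:
  assumes w: "T \<subseteq> {x. length x < length w + 2}"
  shows "Hit T {} (w @ s) \<le> Hit low {} s"
proof -
  define \<Phi> where "\<Phi> x = (if \<exists>z. x = w @ z \<and> 2 \<le> length z then Hit low {} (drop (length w) x) else 1)" for x
  have \<Phi>_le: "\<Phi> x \<le> 1" for x by (simp add: \<Phi>_def Hit_le_1)
  have \<Phi>_eq: "\<Phi> (w @ z) = Hit low {} z" for z
    by (auto simp: \<Phi>_def)
  have "Hit T {} (w @ s) \<le> \<Phi> (w @ s)"
  proof (rule Hit_minimal)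
    fix x
    show "step_op \<Phi> x \<le> \<Phi> x"
    proof (cases "\<exists>z. x = w @ z \<and> 2 \<le> length z")
      case True
      then obtain z where z: "x = w @ z" "2 \<le> length z" by auto
      have "step_op \<Phi> x = step_op (Hit low {}) z" using z by (simp add: step_op_append \<Phi>_eq)
      then show ?thesis using z by (simp add: \<Phi>_eq Hit_superharmonic)
    next
      case False
      have "step_op \<Phi> x \<le> step_op (\<lambda>_. 1) x" by (rule step_op_mono) (rule \<Phi>_le)
      also have "\<dots> = \<Phi> x" unfolding \<Phi>_def using False by (simp only: if_False) simp
      finally show ?thesis .
    qed
  qed (use w in \<open>auto simp: \<Phi>_def Hit_nonneg\<close>)
  then show ?thesis by (simp add: \<Phi>_eq)
qed

text \<open>Induction on the length: once the last two letters have been reduced to fewer than two,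
  the whole word is shorter.\<close>

lemma Hit_short_eq_1:
  assumes "\<And>v. length v = 2 \<Longrightarrow> Hit low {} v = 1"
  shows "Hit low {} x = 1"
proof (induction "length x" arbitrary: x rule: less_induct)
  case less
  show ?case
  proof (cases "length x < 2")
    case False
    define w v where "w = take (length x - 2) x" and "v = drop (length x - 2) x"
    have x: "x = w @ v" "length v = 2" "length x = length w + 2" using False by (auto simp: w_def v_def)
    have "Hit low {} v \<le> Hit low {} (w @ v)"
    proof (rule Hit_minimal)
      fix z assume "z \<notin> low"
      then show "step_op (\<lambda>z. Hit low {} (w @ z)) z \<le> Hit low {} (w @ z)"
        using Hit_superharmonic[of low "w @ z"] by (simp add: step_op_append)
    next
      fix z assume "z \<in> low"
      then show "1 \<le> Hit low {} (w @ z)" using less[of "w @ z"] x by simp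
    qed (simp add: Hit_nonneg)
    then show ?thesis using assms[OF x(2)] Hit_le_1[of low "{}" x] x by simp
  qed simp
qed

end

text \<open>The hypotheses on the walk, expressed by \<open>p\<close> alone:
  \<open>step_op (Hit {w} {}) w\<close> is the probability of returning to \<open>w\<close>, and
  membership in a support stands for positive probability.\<close>

locale transient_word_kernel = word_kernel p for p :: "'a::finite list \<Rightarrow> 'a list pmf" +
  assumes sym: "z \<in> set_pmf (transition_kernel p x) \<Longrightarrow> x \<in> set_pmf (transition_kernel p z)"
    and transient: "w \<in> set_pmf (nstep n []) \<Longrightarrow> step_op (Hit {w} {}) w < 1"
    and irreducible: "w @ [a0, b0] \<in> set_pmf (nstep n []) \<Longrightarrow>
      \<exists>w1. (w @ [a0, b0], w @ w1 @ [a, b]) \<in> (up (length w + 2))\<^sup>*"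
begin

section \<open>Escape and ascent\<close>

definition lang :: "'a list set" where "lang = (\<Union>n. set_pmf (nstep n []))"

lemma closed_lang: "closed_set lang"
  unfolding closed_set_def
proof (intro ballI subsetI)
  fix x z assume "x \<in> lang" "z \<in> set_pmf (K x)"
  then obtain n where "x \<in> set_pmf (nstep n [])" "z \<in> set_pmf (nstep 1 x)"
    by (auto simp: lang_def bind_return_pmf')
  then have "z \<in> set_pmf (nstep (n + 1) [])" unfolding nstep_add by auto
  then show "z \<in> lang" unfolding lang_def by blast
qed

lemma Nil_lang: "[] \<in> lang"
  unfolding lang_def by (rule UN_I[of 0]) auto

lemma nstep_lang: "set_pmf (nstep n []) \<subseteq> lang"
  by (auto simp: lang_def)

lemma lang_reach: "x \<in> lang \<Longrightarrow> (x, y) \<in> (up m)\<^sup>* \<Longrightarrow> y \<in> lang"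
  by (erule rtrancl_induct) (auto simp: up_def dest: closed_setD[OF closed_lang])

lemma sym_up: "sym ((up m)\<^sup>*)"
  by (rule sym_rtrancl) (auto simp: sym_def up_def dest: sym)

lemma up_sym: "(x, y) \<in> (up m)\<^sup>* \<Longrightarrow> (y, x) \<in> (up m)\<^sup>*"
  using sym_up by (rule symD)

lemma lang_connected:
  assumes "x \<in> lang" "y \<in> lang" shows "(x, y) \<in> (up 0)\<^sup>*"
proof -
  have "([], x) \<in> (up 0)\<^sup>*" "([], y) \<in> (up 0)\<^sup>*" using assms nstep_up by (auto simp: lang_def)
  then show ?thesis using up_sym rtrancl_trans by metis
qed

lemma up_rtrancl_mono: "(x, y) \<in> (up m)\<^sup>* \<Longrightarrow> (x, y) \<in> (up 0)\<^sup>*"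
  using rtrancl_mono[OF up_antimono[of 0 m]] by auto

lemma summable_visits:
  assumes "finite T"
  shows "summable (\<lambda>n. measure_pmf.prob (nstep n []) T)"
proof -
  have "summable (\<lambda>n. pmf (nstep n []) w)" for w
  proof (cases "w \<in> lang")
    case True
    then have "step_op (Hit {w} {}) w < 1" using transient by (auto simp: lang_def)
    then have "(\<Sum>i\<le>n. pmf (nstep i []) w) \<le> 1 / (1 - step_op (Hit {w} {}) w)" for n
      using green_bound[of w, where n = "Suc n" and x = "[]"] by (simp add: lessThan_Suc_atMost)
    then show ?thesis by (intro bounded_imp_summable) auto
  next
    case False
    then have "pmf (nstep n []) w = 0" for n using nstep_lang[of n] by (auto simp: set_pmf_iff)
    then show ?thesis by simp
  qed
  then have "summable (\<lambda>n. \<Sum>w\<in>T. pmf (nstep n []) w)" by (rule summable_sum)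
  then show ?thesis by (simp add: measure_measure_pmf_finite assms)
qed

text \<open>Otherwise the walk would spend all its time in a finite set, against
  \<open>summable_visits\<close>.\<close>

lemma lang_long: "\<exists>x\<in>lang. k < length x"
proof (rule ccontr)
  assume "\<not> ?thesis"
  then have "set_pmf (nstep n []) \<subseteq> {x. length x \<le> k}" for n
    using nstep_lang[of n] by (auto simp: not_less)
  then have "measure_pmf.prob (nstep n []) {x. length x \<le> k} = 1" for n
    by (simp add: measure_pmf.prob_eq_1 AE_measure_pmf_iff subset_eq)
  moreover have "(\<lambda>n. measure_pmf.prob (nstep n []) {x. length x \<le> k}) \<longlonglongrightarrow> 0"
    by (rule summable_LIMSEQ_zero[OF summable_visits[OF finite_words]])
  ultimately show False by (simp add: LIMSEQ_const_iff)
qed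

text \<open>If every pair fell into \<open>low\<close> with certainty, so would every word, and the
  finite set \<open>low\<close> would be visited after every time \<open>N\<close>. But the expected
  number of visits after \<open>N\<close> tends to 0.\<close>

lemma escaping_pair: "\<exists>s. length s = 2 \<and> Hit low {} s < 1"
proof (rule ccontr)
  assume "\<not> ?thesis"
  then have "Hit low {} v = 1" if "length v = 2" for v
    using that Hit_le_1[of low "{}" v] by force
  then have "Hit low {} x = 1" for x by (rule Hit_short_eq_1)
  then have one: "Hit low {} = (\<lambda>_. 1)" by (rule ext)
  have fin: "finite low" by (rule finite_subset[OF _ finite_words[of 2]]) auto
  define a where "a n = measure_pmf.prob (nstep n []) low" for n
  have a: "summable a" unfolding a_def by (rule summable_visits[OF fin])
  have "1 \<le> (\<Sum>i. a (i + N))" for N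
  proof -
    have "(\<lambda>m. (step_op ^^ N) (hit m low {}) []) \<longlonglongrightarrow> (step_op ^^ N) (Hit low {}) []"
      by (rule iter_tendsto) (rule hit_tendsto)
    then have lim: "(\<lambda>m. (step_op ^^ N) (hit m low {}) []) \<longlonglongrightarrow> 1" by (simp add: one)
    have "(step_op ^^ N) (hit m low {}) [] \<le> (\<Sum>i. a (i + N))" for m
    proof -
      have "(step_op ^^ N) (hit m low {}) [] \<le> (step_op ^^ N) (\<lambda>x. \<Sum>i\<le>m. (step_op ^^ i) (indicator low) x) []"
        by (rule iter_mono[of UNIV]) (auto simp: hit_le_sum_iter)
      also have "\<dots> = (\<Sum>i\<le>m. a (i + N))"
        by (simp add: iter_sum iter_iter a_def prob_nstep add.commute)
      also have "\<dots> \<le> (\<Sum>i. a (i + N))"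
        using a by (intro sum_le_suminf summable_ignore_initial_segment[OF a]) (auto simp: a_def[of "_ + _"])
      finally show ?thesis .
    qed
    with lim show ?thesis by (intro LIMSEQ_le_const2[OF lim]) auto
  qed
  moreover have "(\<lambda>N. \<Sum>i. a (i + N)) \<longlonglongrightarrow> 0" by (rule suminf_exist_split2[OF a])
  ultimately have "1 \<le> (0::real)" by (intro LIMSEQ_le_const) auto
  then show False by simp
qed

definition esc :: "'a list" where "esc = (SOME s. length s = 2 \<and> Hit low {} s < 1)"

lemma length_esc: "length esc = 2" and Hit_esc: "Hit low {} esc < 1"
  using someI_ex[OF escaping_pair] by (auto simp: esc_def)

lemma growing_pair: "\<exists>a b c. length c = 3 \<and> c \<in> set_pmf (K [a, b])"
proof (rule ccontr)
  assume no: "\<not> ?thesis"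
  have "closed_set {x. length x \<le> 2}"
    unfolding closed_set_def
  proof (intro ballI subsetI)
    fix x z assume x: "x \<in> {x. length x \<le> 2}" and z: "z \<in> set_pmf (K x)"
    show "z \<in> {x. length x \<le> 2}"
    proof (cases "length x = 2")
      case True
      then obtain a b where "x = [a, b]" by (auto simp: length_Suc_conv numeral_2_eq_2)
      then have "length z \<noteq> 3" using no z by auto
      then show ?thesis using K_length(1)[OF z] x by auto
    qed (use K_length(1)[OF z] x in auto)
  qed
  then have "set_pmf (nstep n []) \<subseteq> {x. length x \<le> 2}" for n by (rule nstep_closed) simp
  then have "lang \<subseteq> {x. length x \<le> 2}" by (auto simp: lang_def)
  then show False using lang_long[of 2] by auto
qed

text \<open>Suffix-irreducibility may yield \<open>w1 = []\<close> and hence no growth. The detour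
  through a pair that can grow forces it: the letter \<open>c1\<close> is protected during the
  second application and ends up in \<open>w\<close>. Strict growth puts \<open>w @ esc\<close>
  where a return to the old length requires a descent.\<close>

lemma ascend:
  assumes x: "w0 @ z \<in> lang" "length z = 2"
  shows "\<exists>w. w \<noteq> [] \<and> (z, w @ esc) \<in> (up 2)\<^sup>*"
proof -
  obtain a b c where c: "length c = 3" "c \<in> set_pmf (K [a, b])" using growing_pair by auto
  obtain c1 c2 c3 where c': "c = [c1, c2, c3]" using c(1) by (auto simp: length_Suc_conv numeral_3_eq_3)
  obtain e1 e2 where e: "esc = [e1, e2]" using length_esc by (auto simp: length_Suc_conv numeral_2_eq_2)
  obtain z1 z2 where z: "z = [z1, z2]" using x(2) by (auto simp: length_Suc_conv numeral_2_eq_2)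
  obtain w1 where w1: "(w0 @ z, w0 @ w1 @ [a, b]) \<in> (up (length w0 + 2))\<^sup>*"
    using irreducible[of w0 z1 z2 _ a b] x z by (auto simp: lang_def)
  have "([a, b], c) \<in> up 2" using c by (auto simp: up_def)
  then have "((w0 @ w1) @ [a, b], (w0 @ w1) @ c) \<in> up (length (w0 @ w1) + 2)" by (rule up_append)
  then have s2: "(w0 @ w1 @ [a, b], w0 @ w1 @ c) \<in> up (length w0 + 2)"
    using up_antimono[of "length w0 + 2" "length (w0 @ w1) + 2"] by auto
  have "w0 @ w1 @ c \<in> lang"
    using lang_reach[OF x(1)] rtrancl.rtrancl_into_rtrancl[OF w1 s2] by blast
  then obtain w2 where w2: "((w0 @ w1 @ [c1]) @ [c2, c3], (w0 @ w1 @ [c1]) @ w2 @ esc) \<in> (up (length (w0 @ w1 @ [c1]) + 2))\<^sup>*"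
    using irreducible[of "w0 @ w1 @ [c1]" c2 c3 _ e1 e2] c' e by (auto simp: lang_def)
  then have s3: "(w0 @ w1 @ c, w0 @ (w1 @ [c1] @ w2) @ esc) \<in> (up (length w0 + 2))\<^sup>*"
    using rtrancl_mono[OF up_antimono[of "length w0 + 2" "length (w0 @ w1 @ [c1]) + 2"]] c' by auto
  have "(w0 @ z, w0 @ (w1 @ [c1] @ w2) @ esc) \<in> (up (length w0 + 2))\<^sup>*"
    using w1 s2 s3 by (meson rtrancl.rtrancl_into_rtrancl rtrancl_trans)
  then obtain z' where "w0 @ (w1 @ [c1] @ w2) @ esc = w0 @ z'" "(z, z') \<in> (up 2)\<^sup>*"
    using up_rtrancl_prefix[of w0 z] x(2) by auto
  then show ?thesis by (intro exI[of _ "w1 @ [c1] @ w2"]) simp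
qed

text \<open>The ascent of a long word depends only on its last two letters, since its prefix stays
  untouched; a word in \<open>low\<close> is treated as a whole and may wander freely, hence
  \<open>up 0\<close>. This leaves finitely many \<open>z\<close> to take a maximum over.\<close>

lemma ascend_bounded:
  "\<exists>L. \<forall>x\<in>lang. \<exists>l\<le>L. \<exists>w. w @ esc \<in> set_pmf (nstep l x) \<and> length x < length w + 2"
proof -
  define R where "R z n \<longleftrightarrow> (\<exists>w. (z, w @ esc) \<in> up (if length z = 2 then 2 else 0) ^^ n \<and> length z < length w + 2)" for z n
  have R: "\<exists>z n w0. R z n \<and> x = w0 @ z \<and> length z \<le> 2 \<and> (length z < 2 \<longrightarrow> w0 = [])" if x: "x \<in> lang" for x
  proof (cases "length x < 2")
    case True
    obtain y where y: "y \<in> lang" "2 < length y" using lang_long by blast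
    define w0 z where "w0 = take (length y - 2) y" and "z = drop (length y - 2) y"
    have wz: "y = w0 @ z" "length z = 2" using y by (auto simp: w0_def z_def)
    obtain w where w: "w \<noteq> []" "(z, w @ esc) \<in> (up 2)\<^sup>*" using ascend[of w0 z] y wz by auto
    have "(y, w0 @ w @ esc) \<in> (up 0)\<^sup>*"
      using up_rtrancl_mono[OF up_rtrancl_append[OF w(2)]] wz by auto
    then have "(x, (w0 @ w) @ esc) \<in> (up 0)\<^sup>*"
      using lang_connected[OF x y(1)] by (metis append.assoc rtrancl_trans)
    then obtain n where "(x, (w0 @ w) @ esc) \<in> up 0 ^^ n" using rtrancl_imp_relpow by blast
    then have "R x n" unfolding R_def using True w(1) by (intro exI[of _ "w0 @ w"]) auto
    then show ?thesis using True by (intro exI[of _ x] exI[of _ n] exI[of _ "[]"]) auto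
  next
    case False
    define w0 z where "w0 = take (length x - 2) x" and "z = drop (length x - 2) x"
    have wz: "x = w0 @ z" "length z = 2" using False by (auto simp: w0_def z_def)
    obtain w where w: "w \<noteq> []" "(z, w @ esc) \<in> (up 2)\<^sup>*" using ascend[of w0 z] x wz by auto
    obtain n where "(z, w @ esc) \<in> up 2 ^^ n" using w rtrancl_imp_relpow by blast
    then have "R z n" unfolding R_def using wz w(1) by (intro exI[of _ w]) auto
    then show ?thesis using wz by (intro exI[of _ z] exI[of _ n] exI[of _ w0]) auto
  qed
  \<comment> \<open>For a \<open>z\<close> that admits no \<open>n\<close>, the value is arbitrary
    and can only enlarge \<open>L\<close>.\<close>
  define N where "N z = (SOME n. R z n)" for z
  define L where "L = Max (N ` {z. length z \<le> 2})"
  show ?thesis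
  proof (rule exI[of _ L], intro ballI)
    fix x assume "x \<in> lang"
    then obtain z n w0 where z: "R z n" "x = w0 @ z" "length z \<le> 2" "length z < 2 \<longrightarrow> w0 = []"
      using R by blast
    have "R z (N z)" unfolding N_def by (rule someI[of "R z", OF z(1)])
    then obtain w where w: "(z, w @ esc) \<in> up (if length z = 2 then 2 else 0) ^^ N z" "length z < length w + 2"
      unfolding R_def by auto
    have "N z \<le> L" unfolding L_def using z(3) by (intro Max_ge finite_imageI finite_words) auto
    moreover have "(w0 @ w) @ esc \<in> set_pmf (nstep (N z) x)"
    proof (cases "length z = 2")
      case True
      then show ?thesis using w(1) relpow_up_nstep[OF up_relpow_append[of z "w @ esc" "N z" w0]] z(2) by simp
    next
      case False
      then show ?thesis using w(1) z relpow_up_nstep by auto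
    qed
    ultimately show "\<exists>l\<le>L. \<exists>w. w @ esc \<in> set_pmf (nstep l x) \<and> length x < length w + 2"
      using w(2) z(2) by (intro exI[of _ "N z"] conjI exI[of _ "w0 @ w"]) auto
  qed
qed

lemma ascend_uniform:
  "\<exists>L. \<exists>\<delta>>0. \<delta> \<le> 1 \<and> (\<forall>x\<in>lang. \<exists>l\<le>L. \<exists>w. \<delta> \<le> pmf (nstep l x) (w @ esc) \<and> length x < length w + 2)"
proof -
  obtain \<epsilon> where \<epsilon>: "0 < \<epsilon>" "\<epsilon> \<le> 1" "\<And>x z. z \<in> set_pmf (K x) \<Longrightarrow> \<epsilon> \<le> pmf (K x) z" using min_prob by blast
  obtain L where L: "\<And>x. x \<in> lang \<Longrightarrow> \<exists>l\<le>L. \<exists>w. w @ esc \<in> set_pmf (nstep l x) \<and> length x < length w + 2"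
    using ascend_bounded by blast
  show ?thesis
  proof (rule exI[of _ L], rule exI[of _ "\<epsilon> ^ L"], intro conjI ballI)
    fix x assume "x \<in> lang"
    then obtain l w where l: "l \<le> L" "w @ esc \<in> set_pmf (nstep l x)" "length x < length w + 2" using L by blast
    have "\<epsilon> ^ L \<le> \<epsilon> ^ l" using \<epsilon> l by (intro power_decreasing) auto
    also have "\<dots> \<le> pmf (nstep l x) (w @ esc)" using \<epsilon> l by (intro pmf_nstep_ge) auto
    finally show "\<exists>l\<le>L. \<exists>w. \<epsilon> ^ L \<le> pmf (nstep l x) (w @ esc) \<and> length x < length w + 2"
      using l by blast
  qed (use \<epsilon> in \<open>auto simp: power_le_one\<close>)
qed

section \<open>The probability of ever reaching a word\<close>

definition reach_prob :: "'a list \<Rightarrow> real" where "reach_prob x = Hit {x} {} []"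

lemma reach_prob_nonneg: "0 \<le> reach_prob x"
  by (simp add: reach_prob_def Hit_nonneg)

lemma reach_prob_step: "reach_prob x * pmf (K x) z \<le> reach_prob z"
proof -
  have "reach_prob x * pmf (K x) z \<le> reach_prob x * Hit {z} {} x"
    using Hit_step[of x "{}" z "{z}"] reach_prob_nonneg by (intro mult_left_mono) auto
  also have "\<dots> \<le> reach_prob z" unfolding reach_prob_def by (rule Hit_trans)
  finally show ?thesis .
qed

lemma reach_prob_pos: "x \<in> lang \<Longrightarrow> 0 < reach_prob x"
proof -
  have "0 < reach_prob x" if "x \<in> set_pmf (nstep n [])" for n
    using that
  proof (induction n arbitrary: x)
    case 0
    then show ?case by (simp add: reach_prob_def)
  next
    case (Suc n)
    have "set_pmf (nstep (n + 1) []) = (\<Union>y\<in>set_pmf (nstep n []). set_pmf (K y))"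
      unfolding nstep_add by (simp add: bind_return_pmf')
    then obtain y where y: "y \<in> set_pmf (nstep n [])" "x \<in> set_pmf (K y)" using Suc.prems by auto
    then have "0 < reach_prob y * pmf (K y) x" using Suc.IH by (auto simp: pmf_positive)
    then show ?case using reach_prob_step less_le_trans by blast
  qed
  then show "x \<in> lang \<Longrightarrow> 0 < reach_prob x" by (auto simp: lang_def)
qed

lemma pmf_nstep_le_reach_prob: "pmf (nstep n []) x \<le> reach_prob x"
proof -
  have "(step_op ^^ n) (indicator {x}) y \<le> Hit {x} {} y" for y
  proof (induction n arbitrary: y)
    case 0
    then show ?case by (auto simp: indicator_def Hit_nonneg)
  next
    case (Suc n)
    have "step_op ((step_op ^^ n) (indicator {x})) y \<le> step_op (Hit {x} {}) y" by (rule step_op_mono) (rule Suc.IH)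
    also have "\<dots> \<le> Hit {x} {} y" by (rule Hit_superharmonic)
    finally show ?case by simp
  qed
  then show ?thesis by (simp add: pmf_nstep reach_prob_def)
qed

lemma green_lipschitz:
  "\<exists>C\<ge>0. \<forall>x\<in>lang. \<forall>z\<in>set_pmf (K x). \<bar>- ln (reach_prob z) - - ln (reach_prob x)\<bar> \<le> C"
proof -
  obtain \<epsilon> where \<epsilon>: "0 < \<epsilon>" "\<epsilon> \<le> 1" "\<And>x z. z \<in> set_pmf (K x) \<Longrightarrow> \<epsilon> \<le> pmf (K x) z" using min_prob by blast
  have *: "- ln (reach_prob z) \<le> - ln (reach_prob x) - ln \<epsilon>" if x: "x \<in> lang" and z: "z \<in> set_pmf (K x)" for x z
  proof -
    have "reach_prob x * \<epsilon> \<le> reach_prob x * pmf (K x) z" using \<epsilon>(3)[OF z] reach_prob_nonneg by (intro mult_left_mono) auto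
    also have "\<dots> \<le> reach_prob z" by (rule reach_prob_step)
    finally have "ln (reach_prob x * \<epsilon>) \<le> ln (reach_prob z)" using reach_prob_pos[OF x] \<epsilon> by (intro ln_mono) auto
    then show ?thesis using reach_prob_pos[OF x] \<epsilon> by (simp add: ln_mult)
  qed
  show ?thesis
  proof (intro exI[of _ "- ln \<epsilon>"] conjI ballI)
    show "0 \<le> - ln \<epsilon>" using \<epsilon> by simp
    fix x z assume x: "x \<in> lang" and z: "z \<in> set_pmf (K x)"
    have "z \<in> lang" using closed_setD[OF closed_lang x z] .
    then show "\<bar>- ln (reach_prob z) - - ln (reach_prob x)\<bar> \<le> - ln \<epsilon>"
      using *[OF x z] *[OF _ sym[OF z]] by (simp add: abs_le_iff)
  qed
qed

text \<open>On each level \<open>k\<close> the sum is at most the expected number of visits to words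
  of length \<open>k\<close>, since a word that is reached is visited at least once. From such a
  word the walk gets with probability at least \<open>\<delta>\<close> to some
  \<open>w @ esc\<close> of larger length, and from there it stays above level \<open>k\<close> with
  probability at least \<open>1 - Hit low {} esc\<close>.\<close>

lemma sum_reach_prob_words: "\<exists>C>0. \<forall>n. (\<Sum>x | length x \<le> n. reach_prob x) \<le> C * (real n + 1)"
proof -
  obtain L \<delta> where L: "0 < \<delta>" "\<delta> \<le> 1"
    "\<And>x. x \<in> lang \<Longrightarrow> \<exists>l\<le>L. \<exists>w. \<delta> \<le> pmf (nstep l x) (w @ esc) \<and> length x < length w + 2"
    using ascend_uniform by blast
  define \<gamma> where "\<gamma> = \<delta> * (1 - Hit low {} esc)"
  have \<gamma>: "0 < \<gamma>" using L Hit_esc by (simp add: \<gamma>_def)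
  have level: "(\<Sum>x | length x = k. reach_prob x) \<le> L / \<gamma>" for k
  proof -
    let ?T = "{x. length x = k}"
    have "(step_op ^^ L) (Hit ?T {}) x \<le> 1 - \<gamma>" if x: "x \<in> lang" "x \<in> ?T" for x
    proof -
      obtain l w where l: "l \<le> L" "\<delta> \<le> pmf (nstep l x) (w @ esc)" "length x < length w + 2"
        using L(3)[OF x(1)] by blast
      \<comment> \<open>The time \<open>l\<close> varies with \<open>x\<close>, but
        \<open>expected_visits_bound\<close> wants one exponent. Iterates of a superharmonic
        function decrease, so \<open>l\<close> may be raised to \<open>L\<close>.\<close>
      have "(step_op ^^ L) (Hit ?T {}) x = (step_op ^^ l) ((step_op ^^ (L - l)) (Hit ?T {})) x"
        using l by (simp add: iter_iter)
      also have "\<dots> \<le> (step_op ^^ l) (Hit ?T {}) x"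
        by (rule iter_mono[of UNIV]) (auto simp: Hit_iter_le)
      also have "\<dots> \<le> \<delta> * Hit ?T {} (w @ esc) + (1 - \<delta>) * 1"
        by (rule iter_le_convex[of UNIV]) (use l in \<open>auto simp: Hit_le_1\<close>)
      also have "\<dots> \<le> \<delta> * Hit low {} esc + (1 - \<delta>) * 1"
        using L l x by (intro add_mono mult_left_mono Hit_low_translate) auto
      finally show ?thesis by (simp add: \<gamma>_def algebra_simps)
    qed
    then have "\<gamma> * (\<Sum>n<N. (step_op ^^ n) (indicator ?T) []) \<le> L" for N
      using \<gamma> by (intro expected_visits_bound[OF closed_lang Nil_lang]) auto
    then have visits: "(\<Sum>n<N. (step_op ^^ n) (indicator ?T) []) \<le> L / \<gamma>" for N
      using \<gamma> by (simp add: field_simps)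
    have "(\<Sum>x\<in>?T. hit n {x} {} []) \<le> L / \<gamma>" for n
    proof -
      have "(\<Sum>x\<in>?T. hit n {x} {} []) \<le> (\<Sum>x\<in>?T. \<Sum>i\<le>n. (step_op ^^ i) (indicator {x}) [])"
        by (rule sum_mono) (rule hit_le_sum_iter)
      also have "\<dots> = (\<Sum>i\<le>n. \<Sum>x\<in>?T. pmf (nstep i []) x)"
        by (subst sum.swap) (simp add: pmf_nstep)
      also have "\<dots> = (\<Sum>i<Suc n. (step_op ^^ i) (indicator ?T) [])"
        by (simp add: lessThan_Suc_atMost measure_measure_pmf_finite[OF finite_words_eq, symmetric] prob_nstep del: sum.lessThan_Suc)
      also have "\<dots> \<le> L / \<gamma>" by (rule visits)
      finally show ?thesis .
    qed
    moreover have "(\<lambda>n. \<Sum>x\<in>?T. hit n {x} {} []) \<longlonglongrightarrow> (\<Sum>x\<in>?T. reach_prob x)"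
      unfolding reach_prob_def by (intro tendsto_sum hit_tendsto)
    ultimately show ?thesis by (intro LIMSEQ_le_const2) auto
  qed
  show ?thesis
  \<comment> \<open>The summand 1 keeps the constant positive when \<open>L = 0\<close>.\<close>
  proof (intro exI[of _ "L / \<gamma> + 1"] conjI allI)
    fix n :: nat
    have "(\<Sum>x | length x \<le> n. reach_prob x) = (\<Sum>k\<le>n. \<Sum>x | length x = k. reach_prob x)"
    proof -
      have "{x :: 'a list. length x \<le> n} = (\<Union>k\<in>{..n}. {x. length x = k})" by auto
      then show ?thesis by (simp only:) (subst sum.UNION_disjoint, auto simp: finite_words_eq)
    qed
    also have "\<dots> \<le> (\<Sum>k\<le>n. L / \<gamma> + 1)"
    proof (rule sum_mono)
      fix k show "(\<Sum>x | length x = k. reach_prob x) \<le> L / \<gamma> + 1" using level[of k] by linarith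
    qed
    also have "\<dots> = (L / \<gamma> + 1) * (real n + 1)" by (simp add: mult.commute)
    finally show "(\<Sum>x | length x \<le> n. reach_prob x) \<le> (L / \<gamma> + 1) * (real n + 1)" .
  qed (use \<gamma> in \<open>auto intro: add_nonneg_pos\<close>)
qed

section \<open>Almost additivity of the Green distance\<close>

lemma pair_hitting_bound:
  "\<exists>c>0. \<forall>y y'. length y = 2 \<longrightarrow> length y' = 2 \<longrightarrow> (y, y') \<in> (up 2)\<^sup>* \<longrightarrow> c \<le> Hit {y'} low y"
proof -
  let ?Q = "{x :: 'a list. length x = 2}"
  define A where "A = (\<lambda>(y, y'). Hit {y'} low y) ` ((?Q \<times> ?Q) \<inter> (up 2)\<^sup>*)"
  have "finite A" unfolding A_def by (intro finite_imageI finite_Int disjI1 finite_cartesian_product finite_words_eq)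
  moreover have "A \<noteq> {}" unfolding A_def using length_esc by auto
  ultimately have "Min A \<in> A" and min: "\<And>a. a \<in> A \<Longrightarrow> Min A \<le> a" by auto
  then have "0 < Min A" by (auto simp: A_def Hit_pos)
  moreover have "Min A \<le> Hit {y'} low y" if "length y = 2" "length y' = 2" "(y, y') \<in> (up 2)\<^sup>*" for y y'
    using that by (intro min) (auto simp: A_def)
  ultimately show ?thesis by blast
qed

text \<open>To escape from \<open>y\<close> it suffices to reach \<open>s\<close> before
  \<open>low\<close> and to escape from there. The majorant is the escape probability divided by its
  value at \<open>s\<close>; it is harmonic off \<open>low\<close>.\<close>

lemma Hit_escape: "Hit {s} low y * (1 - Hit low {} s) \<le> 1 - Hit low {} y"
proof (cases "Hit low {} s = 1")
  case True
  then show ?thesis using Hit_le_1[of low "{}" y] by simp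
next
  case False
  then have pos: "0 < 1 - Hit low {} s" using Hit_le_1[of low "{}" s] by simp
  define c where "c = 1 / (1 - Hit low {} s)"
  have c: "0 < c" "c * (1 - Hit low {} s) = 1" using pos by (auto simp: c_def)
  have "Hit {s} low y \<le> c * (1 - Hit low {} y)"
  proof (rule Hit_minimal)
    fix x show "0 \<le> c * (1 - Hit low {} x)" using c Hit_le_1[of low "{}" x] by simp
  next
    fix x assume "x \<in> {s}" then show "1 \<le> c * (1 - Hit low {} x)" using c by simp
  next
    fix x assume "x \<notin> low"
    then show "step_op (\<lambda>x. c * (1 - Hit low {} x)) x \<le> c * (1 - Hit low {} x)"
      by (simp add: step_op_cmult step_op_diff Hit_harmonic)
  qed
  then have "Hit {s} low y * (1 - Hit low {} s) \<le> c * (1 - Hit low {} y) * (1 - Hit low {} s)"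
    using pos by (intro mult_right_mono) auto
  also have "\<dots> = c * (1 - Hit low {} s) * (1 - Hit low {} y)" by simp
  finally show ?thesis by (simp add: c(2))
qed

lemma K_prefix:
  assumes "w @ z' \<in> set_pmf (K x)" "length w + 2 \<le> length x"
  shows "\<exists>x'. x = w @ x' \<and> 2 \<le> length x'"
proof -
  obtain b where b: "w @ z' = take (length x - 2) x @ b"
    using assms(1) by (auto simp: transition_kernel_def)
  have "w = take (length w) (w @ z')" by simp
  also have "\<dots> = take (length w) x" unfolding b using assms(2) by (simp add: min_absorb1 le_diff_conv2)
  finally have "x = w @ drop (length w) x" by (metis append_take_drop_id)
  then show ?thesis using assms(2) by (intro exI[of _ "drop (length w) x"]) auto
qed

text \<open>A route to \<open>w @ v\<close> may avoid \<open>w @ esc\<close>, so no exact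
  factorisation is available. But it enters the component of \<open>w @ v\<close> at some
  \<open>w @ y\<close> with a two-letter \<open>y\<close>, and \<open>y\<close> and
  \<open>esc\<close> hit each other with probability at least \<open>c\<close>. The three factors
  \<open>c\<close> pay for exchanging \<open>y\<close> and \<open>esc\<close> in the probability of
  hitting \<open>v\<close>, in the escape probability and in the arrival;
  \<open>1 - Hit low {} esc\<close> pays for repeated entries.\<close>

lemma reach_prob_append_upper:
  assumes v: "(esc, v) \<in> (up 2)\<^sup>*"
    and c: "0 < c" "\<And>y y'. length y = 2 \<Longrightarrow> length y' = 2 \<Longrightarrow> (y, y') \<in> (up 2)\<^sup>* \<Longrightarrow> c \<le> Hit {y'} low y"
  shows "reach_prob (w @ v) * (c ^ 3 * (1 - Hit low {} esc)) \<le> reach_prob (w @ esc) * Hit {v} low esc"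
proof -
  define q where "q = Hit {v} low esc"
  define \<xi> where "\<xi> = 1 - Hit low {} esc"
  \<comment> \<open>The solution of \<open>q / c + M * (1 - c * \<xi>) = M\<close>: after an entry,
    \<open>v\<close> is hit with probability at most \<open>q / c\<close>, and \<open>low\<close>
    with probability at most \<open>1 - c * \<xi>\<close>, whereupon \<open>M\<close> is charged
    again.\<close>
  define M where "M = q / (c * c * \<xi>)"
  have q: "0 < q" unfolding q_def using v by (rule Hit_pos)
  have \<xi>: "0 < \<xi>" using Hit_esc by (simp add: \<xi>_def)
  have M: "0 < M" using q \<xi> c by (simp add: M_def)
  \<comment> \<open>The factor \<open>1 / c\<close> lifts \<open>g\<close> to 1 at every point of
    entry; the cap at 1 keeps \<open>M * g\<close> below \<open>M\<close>, the charge for leaving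
    the component.\<close>
  define g where "g x = min 1 (1 / c * Hit {w @ esc} {} x)" for x
  have g: "0 \<le> g x" "g x \<le> 1" for x using c Hit_nonneg by (auto simp: g_def)
  have g_super: "step_op g x \<le> g x" for x
  proof -
    have "step_op g x \<le> step_op (\<lambda>_. 1) x" by (rule step_op_mono) (rule g)
    moreover have "step_op g x \<le> step_op (\<lambda>x. 1 / c * Hit {w @ esc} {} x) x"
      by (rule step_op_mono) (simp add: g_def)
    moreover have "step_op (\<lambda>x. 1 / c * Hit {w @ esc} {} x) x \<le> 1 / c * Hit {w @ esc} {} x"
      unfolding step_op_cmult using c Hit_superharmonic[of "{w @ esc}" x] by (intro mult_left_mono) auto
    ultimately show ?thesis by (simp add: g_def)
  qed
  have v2: "2 \<le> length v"
    using up_length[OF up_sym[OF v]] length_esc by simp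
  have comp2: "2 \<le> length x" if "(x, v) \<in> (up 2)\<^sup>*" for x using up_length[OF that v2] .
  \<comment> \<open>A superharmonic majorant of the probability of hitting \<open>w @ v\<close>. The component of \<open>w @ v\<close> above
    level \<open>length w + 2\<close> can only be entered at that level, and \<open>M\<close> is chosen so that
    entering it does not increase \<open>\<Phi>\<close>.\<close>
  define \<Phi> where "\<Phi> x = (if \<exists>x'. x = w @ x' \<and> (x', v) \<in> (up 2)\<^sup>*
    then Hit {v} low (drop (length w) x) + M * Hit low {} (drop (length w) x) else M * g x)" for x
  have \<Phi>_in: "\<Phi> (w @ x) = Hit {v} low x + M * Hit low {} x" if "(x, v) \<in> (up 2)\<^sup>*" for x
    using that by (auto simp: \<Phi>_def)
  have \<Phi>_out: "\<Phi> (w @ x) = M * g (w @ x)" if "(x, v) \<notin> (up 2)\<^sup>*" for x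
    using that by (auto simp: \<Phi>_def)
  have entry: "\<Phi> (w @ y) \<le> M \<and> g (w @ y) = 1" if y: "length y = 2" "(y, v) \<in> (up 2)\<^sup>*" for y
  proof -
    have ye: "(y, esc) \<in> (up 2)\<^sup>*" using y(2) up_sym[OF v] by (rule rtrancl_trans)
    have 1: "c \<le> Hit {esc} low y" using c(2)[OF y(1) length_esc ye] .
    have 2: "c \<le> Hit {y} low esc" using c(2)[OF length_esc y(1) up_sym[OF ye]] .
    have "c * Hit {v} low y \<le> Hit {y} low esc * Hit {v} low y"
      using 2 Hit_nonneg by (rule mult_right_mono)
    also have "\<dots> \<le> q" unfolding q_def by (rule Hit_trans)
    finally have hv: "Hit {v} low y \<le> q / c" using c by (simp add: field_simps)
    have "c * \<xi> \<le> Hit {esc} low y * \<xi>" using 1 \<xi> by (intro mult_right_mono) auto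
    also have "\<dots> \<le> 1 - Hit low {} y" unfolding \<xi>_def by (rule Hit_escape)
    finally have "M * Hit low {} y \<le> M * (1 - c * \<xi>)" using M by (intro mult_left_mono) auto
    moreover have "M * (1 - c * \<xi>) = M - q / c" using c \<xi> by (simp add: M_def field_simps)
    ultimately have "\<Phi> (w @ y) \<le> M" using hv by (simp add: \<Phi>_in[OF y(2)])
    moreover have "c \<le> Hit {w @ esc} {} (w @ y)" using 1 Hit_translate[of esc y w] by simp
    then have "g (w @ y) = 1" using c by (simp add: g_def)
    ultimately show ?thesis by simp
  qed
  have "Hit {w @ v} {} [] \<le> \<Phi> []"
  proof (rule Hit_minimal)
    fix x show "0 \<le> \<Phi> x" using M g by (auto simp: \<Phi>_def Hit_nonneg intro!: add_nonneg_nonneg mult_nonneg_nonneg)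
  next
    fix x assume "x \<in> {w @ v}"
    then show "1 \<le> \<Phi> x" using M Hit_nonneg[of low "{}" v] by (simp add: \<Phi>_in)
  next
    fix x assume xv: "x \<notin> {w @ v}"
    show "step_op \<Phi> x \<le> \<Phi> x"
    proof (cases "\<exists>x'. x = w @ x' \<and> (x', v) \<in> (up 2)\<^sup>*")
      case True
      then obtain x' where x': "x = w @ x'" "(x', v) \<in> (up 2)\<^sup>*" by blast
      have "step_op \<Phi> x = step_op (\<lambda>z. \<Phi> (w @ z)) x'" using x' comp2 by (simp add: step_op_append)
      also have "\<dots> \<le> step_op (\<lambda>z. Hit {v} low z + M * Hit low {} z) x'"
      proof (rule step_op_mono)
        fix z assume z: "z \<in> set_pmf (K x')"
        show "\<Phi> (w @ z) \<le> Hit {v} low z + M * Hit low {} z"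
        proof (cases "(z, v) \<in> (up 2)\<^sup>*")
          case False
          \<comment> \<open>By weak symmetry a successor with at least two letters stays in the
            component, so it is left only through \<open>low\<close>.\<close>
          have "z \<in> low"
          proof (rule ccontr)
            assume "z \<notin> low"
            then have "(z, x') \<in> up 2" using sym[OF z] comp2[OF x'(2)] by (auto simp: up_def)
            then show False using False x'(2) by (meson converse_rtrancl_into_rtrancl)
          qed
          then show ?thesis using M g[of "w @ z"] by (simp add: \<Phi>_out[OF False] Hit_nonneg add_nonneg_nonneg)
            (smt (verit, best) Hit_nonneg mult_left_le)
        qed (simp add: \<Phi>_in)
      qed
      also have "\<dots> = \<Phi> x"
        using x' xv comp2[OF x'(2)] by (simp add: step_op_add step_op_cmult Hit_harmonic \<Phi>_in)
      finally show ?thesis .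
    next
      case False
      have "step_op \<Phi> x \<le> step_op (\<lambda>z. M * g z) x"
      proof (rule step_op_mono)
        fix z assume z: "z \<in> set_pmf (K x)"
        show "\<Phi> z \<le> M * g z"
        proof (cases "\<exists>z'. z = w @ z' \<and> (z', v) \<in> (up 2)\<^sup>*")
          case True
          then obtain z' where z': "z = w @ z'" "(z', v) \<in> (up 2)\<^sup>*" by blast
          \<comment> \<open>A step into a longer word of the component starts at a word that already
            consists of \<open>w\<close> and at least two letters, hence inside the
            component.\<close>
          have "length z' = 2"
          proof (rule ccontr)
            assume "length z' \<noteq> 2"
            then have "length w + 2 \<le> length x" using comp2[OF z'(2)] K_length(1)[OF z] z'(1) by auto
            then obtain x' where x': "x = w @ x'" "2 \<le> length x'" using K_prefix z z'(1) by blast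
            then have "(x', z') \<in> up 2" using z z' comp2[OF z'(2)] by (auto simp: up_def K_append)
            then have "(x', v) \<in> (up 2)\<^sup>*" using z'(2) by (rule converse_rtrancl_into_rtrancl)
            then show False using False x'(1) by blast
          qed
          then show ?thesis using entry[OF _ z'(2)] z'(1) by simp
        next
          case False
          then have "\<Phi> z = M * g z" unfolding \<Phi>_def by (rule if_not_P)
          then show ?thesis by simp
        qed
      qed
      also have "\<dots> \<le> M * g x" unfolding step_op_cmult using M g_super by (intro mult_left_mono) auto
      also have "\<dots> = \<Phi> x" unfolding \<Phi>_def using False by (rule if_not_P[symmetric])
      finally show ?thesis .
    qed
  qed
  also have "\<Phi> [] \<le> M * (1 / c * reach_prob (w @ esc))"
  proof -
    have "\<not> (\<exists>x'. [] = w @ x' \<and> (x', v) \<in> (up 2)\<^sup>*)" using comp2 by fastforce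
    then have "\<Phi> [] = M * g []" unfolding \<Phi>_def by (rule if_not_P)
    also have "\<dots> \<le> M * (1 / c * reach_prob (w @ esc))"
      using M by (intro mult_left_mono) (auto simp: g_def reach_prob_def)
    finally show ?thesis .
  qed
  finally have "reach_prob (w @ v) \<le> M * (1 / c * reach_prob (w @ esc))" by (simp add: reach_prob_def)
  then have "reach_prob (w @ v) * (c ^ 3 * \<xi>) \<le> M * (1 / c * reach_prob (w @ esc)) * (c ^ 3 * \<xi>)"
    using c \<xi> by (intro mult_right_mono) auto
  also have "\<dots> = reach_prob (w @ esc) * q" using c \<xi> by (simp add: M_def field_simps power3_eq_cube)
  finally show ?thesis by (simp add: q_def \<xi>_def)
qed

lemma reach_prob_append_lower: "reach_prob (w @ esc) * Hit {v} low esc \<le> reach_prob (w @ v)"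
proof -
  have "reach_prob (w @ esc) * Hit {v} low esc \<le> reach_prob (w @ esc) * Hit {w @ v} {} (w @ esc)"
    using Hit_translate reach_prob_nonneg by (rule mult_left_mono)
  also have "\<dots> \<le> reach_prob (w @ v)" unfolding reach_prob_def by (rule Hit_trans)
  finally show ?thesis .
qed

abbreviation green :: "'a list \<Rightarrow> real" where "green x \<equiv> - ln (reach_prob x)"

lemma green_append:
  "\<exists>E\<ge>0. \<forall>w w' v. (esc, v) \<in> (up 2)\<^sup>* \<longrightarrow> w @ esc \<in> lang \<longrightarrow> w' @ esc \<in> lang \<longrightarrow>
    \<bar>green (w @ v) - green (w' @ v) - (green (w @ esc) - green (w' @ esc))\<bar> \<le> E"
proof -
  obtain c where c: "0 < c" "\<And>y y'. length y = 2 \<Longrightarrow> length y' = 2 \<Longrightarrow> (y, y') \<in> (up 2)\<^sup>* \<Longrightarrow> c \<le> Hit {y'} low y"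
    using pair_hitting_bound by blast
  define D where "D = c ^ 3 * (1 - Hit low {} esc)"
  have D: "0 < D" using c Hit_esc by (simp add: D_def)
  have bnd: "0 \<le> ln (reach_prob (w @ v)) - ln (reach_prob (w @ esc)) - ln (Hit {v} low esc) \<and>
      ln (reach_prob (w @ v)) - ln (reach_prob (w @ esc)) - ln (Hit {v} low esc) \<le> - ln D"
    if v: "(esc, v) \<in> (up 2)\<^sup>*" and w: "w @ esc \<in> lang" for v w
  proof -
    have q: "0 < Hit {v} low esc" using v by (rule Hit_pos)
    have e: "0 < reach_prob (w @ esc)" using w by (rule reach_prob_pos)
    have lo: "reach_prob (w @ esc) * Hit {v} low esc \<le> reach_prob (w @ v)" by (rule reach_prob_append_lower)
    then have p: "0 < reach_prob (w @ v)" using q e by (meson less_le_trans mult_pos_pos)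
    have "reach_prob (w @ v) * D \<le> reach_prob (w @ esc) * Hit {v} low esc"
      unfolding D_def by (rule reach_prob_append_upper[OF v c])
    then have "ln (reach_prob (w @ v) * D) \<le> ln (reach_prob (w @ esc) * Hit {v} low esc)"
      using p D by (intro ln_mono) auto
    moreover have "ln (reach_prob (w @ esc) * Hit {v} low esc) \<le> ln (reach_prob (w @ v))"
      using lo p e q by (intro ln_mono) auto
    ultimately show ?thesis using p q e D by (simp add: ln_mult)
  qed
  have "0 \<le> - ln D"
  proof -
    obtain l w where "w @ esc \<in> set_pmf (nstep l [])" using ascend_bounded Nil_lang by blast
    then have "w @ esc \<in> lang" using nstep_lang by blast
    then show ?thesis using bnd[of esc w] by (meson order_trans rtrancl.rtrancl_refl)
  qed
  moreover have "\<bar>green (w @ v) - green (w' @ v) - (green (w @ esc) - green (w' @ esc))\<bar> \<le> - ln D"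
    if "(esc, v) \<in> (up 2)\<^sup>*" "w @ esc \<in> lang" "w' @ esc \<in> lang" for w w' v
    using bnd[OF that(1,2)] bnd[OF that(1,3)] by linarith
  ultimately show ?thesis by blast
qed

section \<open>Contraction of the oscillation\<close>

text \<open>The walks from \<open>w @ esc\<close> and \<open>w' @ esc\<close> are compared along
  identical moves after the prefix. Since \<open>D\<close> speaks of the horizon \<open>N\<close>
  exactly, the horizon must not shrink during the first \<open>t\<close> steps: after each of them
  it is restored to \<open>N\<close> at a price of \<open>2 * C\<close>, which is the origin of
  \<open>2 * C * t\<close>.\<close>

lemma oscillation_translates:
  assumes C: "0 \<le> C" "\<And>x z. x \<in> lang \<Longrightarrow> z \<in> set_pmf (K x) \<Longrightarrow> \<bar>green z - green x\<bar> \<le> C"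
    and E: "0 \<le> E" "\<And>v. (esc, v) \<in> (up 2)\<^sup>* \<Longrightarrow> \<bar>green (w @ v) - green (w' @ v) - (green (w @ esc) - green (w' @ esc))\<bar> \<le> E"
    and w: "w @ esc \<in> lang" "w' @ esc \<in> lang"
    and D: "\<And>x y. x \<in> lang \<Longrightarrow> y \<in> lang \<Longrightarrow> \<bar>((step_op ^^ N) green x - green x) - ((step_op ^^ N) green y - green y)\<bar> \<le> D"
  shows "\<bar>((step_op ^^ N) green (w @ esc) - green (w @ esc)) - ((step_op ^^ N) green (w' @ esc) - green (w' @ esc))\<bar> \<le>
    Hit low {} esc * D + (2 * C * t + 2 * C + 2 * E + 2 * C * N * (Hit low {} esc - hit t low {} esc))"
proof -
  \<comment> \<open>Centred at the initial difference, so that \<open>G N esc\<close> is the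
    difference of the two mean increments and \<open>E\<close> bounds \<open>G 0\<close> on the
    component of \<open>esc\<close>.\<close>
  define G where "G n z = (step_op ^^ n) green (w @ z) - (step_op ^^ n) green (w' @ z) - (green (w @ esc) - green (w' @ esc))" for n z
  have step_op_G: "step_op (G n) z = step_op ((step_op ^^ n) green) (w @ z) - step_op ((step_op ^^ n) green) (w' @ z) - (green (w @ esc) - green (w' @ esc))"
    if "2 \<le> length z" for n z
    using that by (simp add: G_def[abs_def] step_op_append step_op_diff)
  have reach: "w @ z \<in> lang \<and> w' @ z \<in> lang" if "(esc, z) \<in> (up 2)\<^sup>*" for z
    using that w lang_reach up_rtrancl_append by blast
  have len: "2 \<le> length z" if "(esc, z) \<in> (up 2)\<^sup>*" for z
    using up_length[OF up_sym[OF that]] length_esc by simp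
  have succ: "w @ z' \<in> lang \<and> w' @ z' \<in> lang \<and> \<bar>green (w @ z') - green (w @ z)\<bar> \<le> C \<and> \<bar>green (w' @ z') - green (w' @ z)\<bar> \<le> C \<and>
      (z' \<notin> low \<longrightarrow> (esc, z') \<in> (up 2)\<^sup>*)" if z: "(esc, z) \<in> (up 2)\<^sup>*" and z': "z' \<in> set_pmf (K z)" for z z'
  proof -
    have "w @ z' \<in> set_pmf (K (w @ z))" "w' @ z' \<in> set_pmf (K (w' @ z))"
      using len[OF z] z' by (auto simp: K_append)
    moreover have "(z, z') \<in> up 2" if "z' \<notin> low" using that len[OF z] z' by (auto simp: up_def)
    ultimately show ?thesis using reach[OF z] C(2) closed_setD[OF closed_lang] z
      by (meson rtrancl.rtrancl_into_rtrancl)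
  qed
  have fallen: "\<bar>G 0 z'\<bar> \<le> 2 * C + E" if z: "(esc, z) \<in> (up 2)\<^sup>*" and z': "z' \<in> set_pmf (K z)" for z z'
    using succ[OF z z'] E(2)[OF z] unfolding G_def by simp linarith
  \<comment> \<open>After a descent, the remaining steps and the step of the descent itself
    contribute at most \<open>2 * C\<close> each, in total at most \<open>2 * C * N\<close>.\<close>
  have short: "\<bar>G n z\<bar> \<le> E + 2 * C * N * hit n low {} z" if "(esc, z) \<in> (up 2)\<^sup>*" "n \<le> N" for n z
    using that
  proof (induction n arbitrary: z)
    case 0
    have "0 \<le> 2 * C * N * hit 0 low {} z" using C hit_nonneg by simp
    then show ?case using E(2)[OF 0(1)] by (simp add: G_def)
  next
    case (Suc n)
    have "\<bar>G (Suc n) z\<bar> = \<bar>step_op (G n) z\<bar>" using len[OF Suc.prems(1)] by (simp add: step_op_G G_def)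
    also have "\<dots> \<le> step_op (\<lambda>z'. \<bar>G n z'\<bar>) z" by (rule step_op_abs)
    also have "\<dots> \<le> step_op (\<lambda>z'. E + 2 * C * N * hit n low {} z') z"
    proof (rule step_op_mono)
      fix z' assume z': "z' \<in> set_pmf (K z)"
      note nx = succ[OF Suc.prems(1) z']
      show "\<bar>G n z'\<bar> \<le> E + 2 * C * N * hit n low {} z'"
      proof (cases "z' \<in> low")
        case True
        then have h: "hit n low {} z' = 1" by (cases n) auto
        have "\<bar>(step_op ^^ n) green (w @ z') - green (w @ z')\<bar> \<le> C * n" "\<bar>(step_op ^^ n) green (w' @ z') - green (w' @ z')\<bar> \<le> C * n"
          using nx by (simp_all only: iter_lipschitz(2)[where f = green, OF closed_lang C(2)])
        then have "\<bar>G n z'\<bar> \<le> 2 * (C * n) + \<bar>G 0 z'\<bar>" unfolding G_def by simp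
        also have "\<dots> \<le> E + 2 * (C * Suc n)" using fallen[OF Suc.prems(1) z'] by (simp add: algebra_simps)
        also have "\<dots> \<le> E + 2 * (C * N)" using C Suc.prems(2) by (intro add_mono mult_left_mono) auto
        finally show ?thesis by (simp add: h)
      qed (use Suc nx in auto)
    qed
    also have "\<dots> = E + 2 * C * N * hit (Suc n) low {} z"
      using len[OF Suc.prems(1)] by (simp add: step_op_add step_op_cmult)
    finally show ?case .
  qed
  \<comment> \<open>Two phases: a departure within \<open>t\<close> steps costs \<open>D\<close> and the \<open>t\<close> steps already taken, a later one
    costs \<open>O(N)\<close> but has small probability.\<close>
  define b where "b t z = 2 * C * real t + hit t low {} z * (D + 2 * C + E) + E +
    2 * C * N * (hit (t + N) low {} z - hit t low {} z)" for t z
  have D0: "0 \<le> D" using D[OF Nil_lang Nil_lang] by simp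
  have "\<bar>G N z\<bar> \<le> b t z" if "(esc, z) \<in> (up 2)\<^sup>*" for z
    using that
  proof (induction t arbitrary: z)
    case 0
    have "hit 0 low {} z = 0" using len[OF 0] by simp
    then show ?case using short[OF 0 order_refl] by (simp add: b_def)
  next
    case (Suc t)
    have lip: "\<bar>step_op ((step_op ^^ N) green) x - (step_op ^^ N) green x\<bar> \<le> C" if "x \<in> lang" for x
      using C(2) that by (intro iter_lipschitz(1)[OF closed_lang]) auto
    have "\<bar>G N z\<bar> \<le> \<bar>step_op (G N) z\<bar> + 2 * C"
      using lip[of "w @ z"] lip[of "w' @ z"] reach[OF Suc.prems] len[OF Suc.prems]
      unfolding step_op_G[OF len[OF Suc.prems]] unfolding G_def by linarith
    moreover have "\<bar>step_op (G N) z\<bar> \<le> step_op (\<lambda>z'. \<bar>G N z'\<bar>) z" by (rule step_op_abs)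
    moreover have "step_op (\<lambda>z'. \<bar>G N z'\<bar>) z \<le> step_op (b t) z"
    proof (rule step_op_mono)
      fix z' assume z': "z' \<in> set_pmf (K z)"
      note nx = succ[OF Suc.prems z']
      show "\<bar>G N z'\<bar> \<le> b t z'"
      proof (cases "z' \<in> low")
        case True
        then have h: "hit m low {} z' = 1" for m by (cases m) auto
        have "G N z' = (((step_op ^^ N) green (w @ z') - green (w @ z')) - ((step_op ^^ N) green (w' @ z') - green (w' @ z'))) + G 0 z'"
          unfolding G_def by simp
        then have "\<bar>G N z'\<bar> \<le> D + (2 * C + E)"
          using D[of "w @ z'" "w' @ z'"] nx fallen[OF Suc.prems z'] by linarith
        also have "\<dots> \<le> b t z'" using C E by (simp add: b_def h)
        finally show ?thesis .
      qed (use Suc nx in auto)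
    qed
    moreover have "step_op (b t) z + 2 * C = b (Suc t) z"
      using len[OF Suc.prems]
      by (simp add: b_def[abs_def] step_op_add step_op_cmult step_op_diff mult.commute[of _ "D + 2 * C + E"] algebra_simps)
    ultimately show ?case by linarith
  qed
  then have "\<bar>G N esc\<bar> \<le> b t esc" by simp
  also have "\<dots> \<le> 2 * C * t + Hit low {} esc * D + (2 * C + E) + E + 2 * C * N * (Hit low {} esc - hit t low {} esc)"
  proof -
    have "hit t low {} esc * D \<le> Hit low {} esc * D" using hit_le_Hit D0 by (rule mult_right_mono)
    moreover have "hit t low {} esc * (2 * C + E) \<le> 1 * (2 * C + E)"
      using hit_le_1 C E by (intro mult_right_mono) auto
    moreover have "2 * C * N * (hit (t + N) low {} esc - hit t low {} esc) \<le> 2 * C * N * (Hit low {} esc - hit t low {} esc)"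
      using C hit_le_Hit by (intro mult_left_mono) auto
    ultimately show ?thesis unfolding b_def by (simp add: algebra_simps)
  qed
  finally show ?thesis unfolding G_def by (simp add: algebra_simps)
qed

text \<open>The order of choices matters. First \<open>t\<close> is fixed from
  \<open>\<epsilon>\<close>, so that late descents contribute at most half of
  \<open>\<epsilon> * (1 - \<beta>) * N\<close>; then \<open>N\<close> is taken so large that the
  constant \<open>A\<close>, which contains \<open>t\<close>, is at most the other half.\<close>

lemma small_oscillation:
  assumes \<epsilon>: "0 < \<epsilon>"
  shows "\<exists>N>0. \<forall>x\<in>lang. \<forall>y\<in>lang. \<bar>((step_op ^^ N) green x - green x) - ((step_op ^^ N) green y - green y)\<bar> \<le> \<epsilon> * real N"
proof -
  obtain C where C: "0 \<le> C" "\<And>x z. x \<in> lang \<Longrightarrow> z \<in> set_pmf (K x) \<Longrightarrow> \<bar>green z - green x\<bar> \<le> C"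
    using green_lipschitz by blast
  obtain E where E: "0 \<le> E" "\<And>w w' v. (esc, v) \<in> (up 2)\<^sup>* \<Longrightarrow> w @ esc \<in> lang \<Longrightarrow> w' @ esc \<in> lang \<Longrightarrow>
    \<bar>green (w @ v) - green (w' @ v) - (green (w @ esc) - green (w' @ esc))\<bar> \<le> E"
    using green_append by blast
  obtain L \<delta> where L: "0 < \<delta>" "\<delta> \<le> 1"
    "\<And>x. x \<in> lang \<Longrightarrow> \<exists>l\<le>L. \<exists>w. \<delta> \<le> pmf (nstep l x) (w @ esc) \<and> length x < length w + 2"
    using ascend_uniform by blast
  define \<beta> where "\<beta> = Hit low {} esc"
  have \<beta>: "\<beta> < 1" unfolding \<beta>_def by (rule Hit_esc)
  \<comment> \<open>With \<open>C + 1\<close> in place of \<open>C\<close>, \<open>\<eta>\<close> is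
    positive even if \<open>C = 0\<close>.\<close>
  define \<eta> where "\<eta> = \<epsilon> * (1 - \<beta>) / (4 * (C + 1))"
  have \<eta>: "0 < \<eta>" using \<epsilon> \<beta> C by (simp add: \<eta>_def)
  have "(\<lambda>t. hit t low {} esc) \<longlonglongrightarrow> \<beta>" unfolding \<beta>_def by (rule hit_tendsto)
  then have "eventually (\<lambda>t. \<beta> - \<eta> < hit t low {} esc) sequentially"
    using \<eta> by (intro order_tendstoD(1)) auto
  then have "\<exists>t. \<beta> - \<eta> < hit t low {} esc" by (rule eventually_happens'[OF sequentially_bot])
  then obtain t where "\<beta> - \<eta> < hit t low {} esc" by blast
  then have t: "\<beta> - hit t low {} esc \<le> \<eta>" by linarith
  define A where "A = 2 * C * t + 2 * C + 2 * E + 2 * (2 * C * L) / \<delta>"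
  obtain N0 :: nat where "A / (\<epsilon> * (1 - \<beta>) / 2) \<le> N0" using real_arch_simple by blast
  then obtain N :: nat where N: "0 < N" "A / (\<epsilon> * (1 - \<beta>) / 2) \<le> N"
    by (intro that[of "Suc N0"]) auto
  have "\<bar>((step_op ^^ N) green x - green x) - ((step_op ^^ N) green y - green y)\<bar> \<le> \<epsilon> * real N" if x: "x \<in> lang" and y: "y \<in> lang" for x y
  proof -
    define U where "U x = (step_op ^^ N) green x - green x" for x
    define e where "e = 2 * C * t + 2 * C + 2 * E + 2 * C * N * (\<beta> - hit t low {} esc)"
    have "\<bar>U x - U y\<bar> \<le> (e + 2 * (2 * C * L) / \<delta>) / (1 - \<beta>)"
    proof (rule oscillation_contraction[OF closed_lang, where G = "{w @ esc |w. w @ esc \<in> lang}" and B = "C * N" and L = L])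
      fix x assume x: "x \<in> lang"
      show "\<bar>U x\<bar> \<le> C * N" unfolding U_def using C(2) x by (intro iter_lipschitz(2)[OF closed_lang]) auto
      obtain l w where l: "l \<le> L" "\<delta> \<le> pmf (nstep l x) (w @ esc)" using L(3)[OF x] by blast
      then have "w @ esc \<in> set_pmf (nstep l x)" using L(1) by (auto simp: set_pmf_iff)
      then have "w @ esc \<in> lang" using nstep_closed[OF closed_lang x] by blast
      then show "\<exists>l\<le>L. \<exists>y\<in>{w @ esc |w. w @ esc \<in> lang}. \<delta> \<le> pmf (nstep l x) y" using l by blast
    next
      fix y y' D assume y: "y \<in> {w @ esc |w. w @ esc \<in> lang}" "y' \<in> {w @ esc |w. w @ esc \<in> lang}"
        and D: "\<And>x x'. x \<in> lang \<Longrightarrow> x' \<in> lang \<Longrightarrow> \<bar>U x - U x'\<bar> \<le> D"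
      then obtain w w' where w: "y = w @ esc" "y' = w' @ esc" "w @ esc \<in> lang" "w' @ esc \<in> lang" by auto
      have "\<bar>U (w @ esc) - U (w' @ esc)\<bar> \<le> Hit low {} esc * D + (2 * C * t + 2 * C + 2 * E + 2 * C * N * (Hit low {} esc - hit t low {} esc))"
        unfolding U_def using C E(2)[OF _ w(3,4)] E(1) w(3,4) D[unfolded U_def] by (intro oscillation_translates) auto
      then show "\<bar>U y - U y'\<bar> \<le> \<beta> * D + e" unfolding \<beta>_def e_def w by simp
    next
      fix x l assume x: "x \<in> lang" and l: "l \<le> L"
      have z: "\<bar>(step_op ^^ l) green z - green z\<bar> \<le> C * l" if "z \<in> lang" for z
        using C(2) that by (intro iter_lipschitz(2)[OF closed_lang]) auto
      \<comment> \<open>The iterates commute, so the shift of \<open>U\<close> is the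
        \<open>N\<close>-step mean of an \<open>l\<close>-step increment minus that increment. This
        makes the cost \<open>2 * C * L\<close> independent of \<open>N\<close>.\<close>
      have "(step_op ^^ l) U x - U x = (step_op ^^ N) (\<lambda>z. (step_op ^^ l) green z - green z) x - ((step_op ^^ l) green x - green x)"
        unfolding U_def[abs_def] iter_diff iter_iter by (simp add: add.commute)
      moreover have "\<bar>(step_op ^^ N) (\<lambda>z. (step_op ^^ l) green z - green z) x\<bar> \<le> C * l"
        using iter_abs_diff_le[OF closed_lang x, of "\<lambda>z. (step_op ^^ l) green z - green z" 0 "C * l" N] z by simp
      ultimately have "\<bar>(step_op ^^ l) U x - U x\<bar> \<le> 2 * (C * l)" using z[OF x] by linarith
      also have "\<dots> \<le> 2 * C * L" using C l by (simp add: mult_left_mono)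
      finally show "\<bar>(step_op ^^ l) U x - U x\<bar> \<le> 2 * C * L" .
    qed (use L \<beta> x y in auto)
    also have "\<dots> \<le> \<epsilon> * N"
    proof -
      have "2 * C * N * (\<beta> - hit t low {} esc) \<le> 2 * (C + 1) * N * \<eta>"
        using C t \<eta> hit_le_Hit[of t low "{}" esc] by (intro mult_mono) (auto simp: \<beta>_def)
      also have "\<dots> = \<epsilon> * (1 - \<beta>) / 2 * N" using C by (simp add: \<eta>_def field_simps)
      finally have 1: "2 * C * N * (\<beta> - hit t low {} esc) \<le> \<epsilon> * (1 - \<beta>) / 2 * N" .
      have "0 < \<epsilon> * (1 - \<beta>) / 2" using \<epsilon> \<beta> by simp
      then have 2: "A \<le> \<epsilon> * (1 - \<beta>) / 2 * N" using N(2) by (simp add: pos_divide_le_eq mult.commute)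
      have "e + 2 * (2 * C * L) / \<delta> \<le> \<epsilon> * (1 - \<beta>) / 2 * N + \<epsilon> * (1 - \<beta>) / 2 * N"
        using 1 2 unfolding e_def A_def by linarith
      also have "\<dots> = \<epsilon> * N * (1 - \<beta>)" by (simp add: algebra_simps)
      finally show ?thesis using \<beta> by (simp add: pos_divide_le_eq)
    qed
    finally show ?thesis unfolding U_def .
  qed
  with N(1) show ?thesis by blast
qed

end

section \<open>The law of the walk\<close>

context fin_kernel
begin

text \<open>The law of the first \<open>n + 1\<close> states. Extension at the end matches the
  Markov hypothesis; \<open>path_Suc\<close> splits off the first step, as the recursion of
  \<open>hit\<close> does.\<close>

primrec path :: "nat \<Rightarrow> 's \<Rightarrow> 's list pmf" where
  "path 0 x = return_pmf [x]"
| "path (Suc n) x = bind_pmf (path n x) (\<lambda>xs. map_pmf (\<lambda>v. xs @ [v]) (K (last xs)))"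

lemma path_nonempty: "xs \<in> set_pmf (path n x) \<Longrightarrow> xs \<noteq> []"
  by (cases n) auto

lemma path_Suc: "path (Suc n) x = bind_pmf (K x) (\<lambda>z. map_pmf ((#) x) (path n z))"
proof (induction n)
  case 0
  show ?case by (simp add: bind_return_pmf map_pmf_def)
next
  case (Suc n)
  have "path (Suc (Suc n)) x = bind_pmf (path (Suc n) x) (\<lambda>xs. map_pmf (\<lambda>v. xs @ [v]) (K (last xs)))" by simp
  also have "\<dots> = bind_pmf (K x) (\<lambda>z. bind_pmf (path n z) (\<lambda>xs. map_pmf (\<lambda>v. (x # xs) @ [v]) (K (last (x # xs)))))"
    unfolding Suc.IH by (simp add: bind_assoc_pmf bind_map_pmf)
  also have "\<dots> = bind_pmf (K x) (\<lambda>z. bind_pmf (path n z) (\<lambda>xs. map_pmf ((#) x) (map_pmf (\<lambda>v. xs @ [v]) (K (last xs)))))"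
    by (intro bind_pmf_cong refl) (auto simp: map_pmf_comp dest!: path_nonempty)
  also have "\<dots> = bind_pmf (K x) (\<lambda>z. map_pmf ((#) x) (path (Suc n) z))"
    by (simp add: map_bind_pmf)
  finally show ?case .
qed

lemma path_last: "map_pmf last (path n x) = nstep n x"
proof (induction n arbitrary: x)
  case (Suc n)
  have "map_pmf last (path (Suc n) x) = bind_pmf (K x) (\<lambda>z. map_pmf (\<lambda>xs. last (x # xs)) (path n z))"
    unfolding path_Suc by (simp add: map_bind_pmf map_pmf_comp del: last.simps)
  also have "\<dots> = bind_pmf (K x) (\<lambda>z. map_pmf last (path n z))"
    by (intro bind_pmf_cong refl map_pmf_cong) (auto dest: path_nonempty)
  finally show ?case by (simp add: Suc.IH)
qed simp

lemma prob_path_Suc: "measure_pmf.prob (path (Suc n) x) {xs. Q xs} =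
    step_op (\<lambda>z. measure_pmf.prob (path n z) {xs. Q (x # xs)}) x"
proof -
  have "measure_pmf.prob (path (Suc n) x) {xs. Q xs} =
      measure_pmf.expectation (bind_pmf (K x) (\<lambda>z. map_pmf ((#) x) (path n z))) (indicator {xs. Q xs})"
    by (simp add: path_Suc del: path.simps)
  also have "\<dots> = (\<Sum>z\<in>set_pmf (K x). pmf (K x) z *\<^sub>R measure_pmf.expectation (map_pmf ((#) x) (path n z)) (indicator {xs. Q xs}))"
  proof (rule pmf_expectation_bind)
    have "finite (set_pmf (path n z))" for z by (induction n) (auto simp: finite_K)
    then show "finite (set_pmf (map_pmf ((#) x) (path n z)))" for z by simp
  qed (auto simp: finite_K)
  also have "\<dots> = step_op (\<lambda>z. measure_pmf.prob (path n z) {xs. Q (x # xs)}) x"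
    by (simp add: step_op_def vimage_def)
  finally show ?thesis .
qed

lemma prob_path_hit: "measure_pmf.prob (path n x) {xs. \<exists>y\<in>set xs. y \<in> T} = hit n T {} x"
proof (induction n arbitrary: x)
  case 0
  show ?case by (simp add: indicator_def)
next
  case (Suc n)
  show ?case
  proof (cases "x \<in> T")
    case True
    then show ?thesis by (simp add: prob_path_Suc del: path.simps)
  next
    case False
    then show ?thesis by (simp add: prob_path_Suc Suc.IH[abs_def] del: path.simps)
  qed
qed

lemma prob_path_return: "measure_pmf.prob (path (Suc n) x) {xs. \<exists>y\<in>set (tl xs). y \<in> T} = step_op (hit n T {}) x"
  by (simp only: prob_path_Suc list.sel prob_path_hit)

end

lemma measure_eqI_countable_UNIV:
  fixes M N :: "'b::countable measure"
  assumes "sets M = UNIV" "sets N = UNIV" "\<And>x. emeasure M {x} = emeasure N {x}"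
  shows "M = N"
  by (rule measure_eqI_countable[of _ UNIV]) (use assms in auto)

context regular_language_walk
begin

sublocale word_kernel p
  by unfold_locales (rule local)

section \<open>Laws of finite histories\<close>

definition history :: "nat \<Rightarrow> 'w \<Rightarrow> 'a list list" where
  "history n \<omega> = map (\<lambda>i. X i \<omega>) [0..<Suc n]"

lemma history_Suc: "history (Suc n) \<omega> = history n \<omega> @ [X (Suc n) \<omega>]"
  by (simp add: history_def)

lemma history_eq_iff: "history n \<omega> = xs \<longleftrightarrow> length xs = Suc n \<and> (\<forall>i\<le>n. X i \<omega> = xs ! i)"
  by (auto simp: history_def list_eq_iff_nth_eq less_Suc_eq_le simp del: upt_Suc)

lemma last_history: "last (history n \<omega>) = X n \<omega>"
  by (simp add: history_def)

lemma measurable_X_event: "{\<omega> \<in> space (P w). Q (X n \<omega>)} \<in> sets (P w)"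
  using measurable_sets[OF measurable_X[of n w], of "{x. Q x}"] by (simp add: vimage_def Int_def conj_commute)

lemma measurable_history_event: "{\<omega> \<in> space (P w). history n \<omega> = xs} \<in> sets (P w)"
proof -
  have "(\<Inter>i\<in>{..n}. {\<omega> \<in> space (P w). X i \<omega> = xs ! i}) \<in> sets (P w)"
    by (rule sets.finite_INT) (auto intro: measurable_X_event)
  also have "(\<Inter>i\<in>{..n}. {\<omega> \<in> space (P w). X i \<omega> = xs ! i}) = {\<omega> \<in> space (P w). \<forall>i\<le>n. X i \<omega> = xs ! i}"
    by auto
  finally have path: "{\<omega> \<in> space (P w). \<forall>i\<le>n. X i \<omega> = xs ! i} \<in> sets (P w)" .
  show ?thesis
  proof (cases "length xs = Suc n")
    case True
    show ?thesis unfolding history_eq_iff using True path by (simp only: simp_thms)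
  next
    case False
    then have empty: "{\<omega> \<in> space (P w). history n \<omega> = xs} = {}"
      unfolding history_eq_iff by (simp only: simp_thms Collect_empty_eq)
    show ?thesis unfolding empty by (rule sets.empty_sets)
  qed
qed

lemma measurable_history: "history n \<in> P w \<rightarrow>\<^sub>M count_space UNIV"
proof (rule measurableI)
  have "{\<omega> \<in> space (P w). history n \<omega> \<in> A} = (\<Union>xs\<in>A. {\<omega> \<in> space (P w). history n \<omega> = xs})" for A by auto
  moreover have "(\<Union>xs\<in>A. {\<omega> \<in> space (P w). history n \<omega> = xs}) \<in> sets (P w)" for A
    by (intro sets.countable_UN') (auto intro: measurable_history_event)
  ultimately show "history n -` A \<inter> space (P w) \<in> sets (P w)" for A
    by (simp add: vimage_def Int_def conj_commute)
qed simp

lemma prob_history: "\<P>(\<omega> in P w. history n \<omega> = xs) = pmf (path n w) xs"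
proof (induction n arbitrary: xs)
  interpret prob_space "P w" by (rule prob_space_P)
  case 0
  have X0: "prob {\<omega> \<in> space (P w). X 0 \<omega> = w} = 1" by (rule start)
  show ?case
  proof (cases "xs = [w]")
    case True
    then show ?thesis using X0 by (simp add: history_def)
  next
    case False
    have "prob {\<omega> \<in> space (P w). history 0 \<omega> = xs} \<le> prob (space (P w) - {\<omega> \<in> space (P w). X 0 \<omega> = w})"
      using False by (intro finite_measure_mono) (auto simp: history_def intro: measurable_X_event)
    also have "\<dots> = 0" using X0 by (subst prob_compl) (auto intro: measurable_X_event)
    finally show ?thesis using False measure_nonneg[of "P w"] by (simp add: pmf_return indicator_def antisym)
  qed
next
  interpret prob_space "P w" by (rule prob_space_P)
  case (Suc n)
  show ?case
  proof (cases "xs = []")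
    case True
    then have "xs \<notin> set_pmf (path (Suc n) w)" using path_nonempty by blast
    then have "pmf (path (Suc n) w) xs = 0" by (simp only: set_pmf_iff not_not)
    then show ?thesis using True by (simp add: history_def)
  next
    case False
    define ys v where "ys = butlast xs" and "v = last xs"
    have xs: "xs = ys @ [v]" using False by (simp add: ys_def v_def)
    have rhs: "pmf (path (Suc n) w) xs = pmf (path n w) ys * pmf (K (last ys)) v"
    proof -
      have "pmf (map_pmf (\<lambda>u. zs @ [u]) (K (last zs))) (ys @ [v]) = indicator {ys} zs * pmf (K (last ys)) v" for zs
      proof (cases "zs = ys")
        case True
        then show ?thesis using pmf_map_inj'[of "\<lambda>u. ys @ [u]" "K (last ys)" v] by (simp add: inj_def)
      next
        case False
        then have "ys @ [v] \<notin> set_pmf (map_pmf (\<lambda>u. zs @ [u]) (K (last zs)))" by auto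
        then have "pmf (map_pmf (\<lambda>u. zs @ [u]) (K (last zs))) (ys @ [v]) = 0"
          by (simp only: set_pmf_iff not_not)
        then show ?thesis using False by simp
      qed
      then show ?thesis unfolding xs path.simps pmf_bind by (simp add: measure_pmf_single)
    qed
    have lhs: "prob {\<omega> \<in> space (P w). history (Suc n) \<omega> = xs} =
        prob {\<omega> \<in> space (P w). history n \<omega> = ys} * pmf (K (last ys)) v"
    \<comment> \<open>\<open>markov\<close> speaks only of histories of positive probability; for
      the others both sides are 0.\<close>
    proof (cases "0 < prob {\<omega> \<in> space (P w). history n \<omega> = ys}")
      case True
      have len: "length ys = Suc n"
      proof (rule ccontr)
        assume "length ys \<noteq> Suc n"
        then have "{\<omega> \<in> space (P w). history n \<omega> = ys} = {}" by (auto simp: history_eq_iff)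
        with True show False by simp
      qed
      have eq: "history n \<omega> = ys \<longleftrightarrow> (\<forall>i\<le>n. X i \<omega> = ys ! i)" for \<omega> using len by (simp add: history_eq_iff)
      have "\<P>(\<omega> in P w. X (Suc n) \<omega> = v \<bar> \<forall>i\<le>n. X i \<omega> = ys ! i) = pmf (K (ys ! n)) v"
        using True by (intro markov) (simp add: eq)
      moreover have "ys ! n = last ys" using len by (metis diff_Suc_1 last_conv_nth list.size(3) nat.distinct(1))
      ultimately have "prob {\<omega> \<in> space (P w). X (Suc n) \<omega> = v \<and> history n \<omega> = ys} =
          prob {\<omega> \<in> space (P w). history n \<omega> = ys} * pmf (K (last ys)) v"
        using True unfolding cond_prob_def eq by (simp add: field_simps)
      then show ?thesis by (simp add: xs history_Suc conj_commute)
    next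
      case False
      then have 0: "prob {\<omega> \<in> space (P w). history n \<omega> = ys} = 0" using measure_nonneg[of "P w"] by (simp add: not_less antisym)
      have "prob {\<omega> \<in> space (P w). history (Suc n) \<omega> = xs} \<le> prob {\<omega> \<in> space (P w). history n \<omega> = ys}"
        by (intro finite_measure_mono) (auto simp: xs history_Suc intro: measurable_history_event)
      then show ?thesis using 0 measure_nonneg[of "P w"] by (simp add: antisym)
    qed
    show ?thesis unfolding lhs rhs Suc.IH ..
  qed
qed

lemma distr_history: "distr (P w) (count_space UNIV) (history n) = measure_pmf (path n w)"
proof (rule measure_eqI_countable_UNIV)
  interpret prob_space "P w" by (rule prob_space_P)
  fix xs
  have "emeasure (distr (P w) (count_space UNIV) (history n)) {xs} = emeasure (P w) {\<omega> \<in> space (P w). history n \<omega> = xs}"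
    by (subst emeasure_distr[OF measurable_history]) (auto intro!: arg_cong[of _ _ "emeasure (P w)"])
  also have "\<dots> = ennreal (pmf (path n w) xs)"
    unfolding emeasure_eq_measure prob_history ..
  finally show "emeasure (distr (P w) (count_space UNIV) (history n)) {xs} = emeasure (measure_pmf (path n w)) {xs}"
    by (simp add: emeasure_pmf_single)
qed auto

lemma prob_history_event: "\<P>(\<omega> in P w. Q (history n \<omega>)) = measure_pmf.prob (path n w) {xs. Q xs}"
  unfolding distr_history[symmetric]
  by (subst measure_distr[OF measurable_history]) (auto intro!: arg_cong[of _ _ "measure (P w)"])

lemma distr_X: "distr (P w) (count_space UNIV) (X n) = measure_pmf (nstep n w)"
proof -
  have "distr (P w) (count_space UNIV) (X n) = distr (distr (P w) (count_space UNIV) (history n)) (count_space UNIV) last"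
    by (subst distr_distr[OF _ measurable_history]) (auto simp: comp_def last_history)
  then show ?thesis by (simp add: distr_history path_last[symmetric] map_pmf_rep_eq)
qed

lemma prob_X: "\<P>(\<omega> in P w. Q (X n \<omega>)) = measure_pmf.prob (nstep n w) {x. Q x}"
  unfolding distr_X[symmetric]
  by (subst measure_distr[OF measurable_X]) (auto intro!: arg_cong[of _ _ "measure (P w)"])

lemma prob_X_eq: "\<P>(\<omega> in P w. X n \<omega> = v) = pmf (nstep n w) v"
  using prob_X[of w "\<lambda>x. x = v" n] by (simp add: measure_pmf_single)

lemma language_eq: "walk_language P X = (\<Union>n. set_pmf (nstep n []))"
  by (auto simp: walk_language_def prob_X_eq pmf_positive_iff)

lemma set_history: "set (history n \<omega>) = {X i \<omega> |i. i \<le> n}"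
  by (auto simp: history_def less_Suc_eq_le image_iff simp del: upt_Suc)

lemma set_tl_history: "set (tl (history (Suc n) \<omega>)) = {X i \<omega> |i. 1 \<le> i \<and> i \<le> Suc n}"
proof -
  have "history (Suc n) \<omega> = X 0 \<omega> # map (\<lambda>i. X i \<omega>) [1..<Suc (Suc n)]"
    unfolding history_def by (subst upt_conv_Cons) auto
  then show ?thesis by (auto simp: less_Suc_eq_le image_iff simp del: upt_Suc)
qed

text \<open>Continuity from below, stated with time sets \<open>A n\<close> so that it covers
  hitting times from 0 on and return times from 1 on.\<close>

lemma prob_ever:
  assumes "\<And>n. \<P>(\<omega> in P w. \<exists>i\<in>A n. X i \<omega> = v) = h n" "incseq A" "h \<longlonglongrightarrow> l"
  shows "\<P>(\<omega> in P w. \<exists>i\<in>(\<Union>n. A n). X i \<omega> = v) = l"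
proof -
  interpret prob_space "P w" by (rule prob_space_P)
  let ?B = "\<lambda>n. {\<omega> \<in> space (P w). \<exists>i\<in>A n. X i \<omega> = v}"
  have "?B n = (\<Union>i\<in>A n. {\<omega> \<in> space (P w). X i \<omega> = v})" for n by auto
  moreover have "(\<Union>i\<in>A n. {\<omega> \<in> space (P w). X i \<omega> = v}) \<in> events" for n
    by (intro sets.countable_UN') (auto intro: measurable_X_event)
  ultimately have "range ?B \<subseteq> events" by auto
  moreover have "incseq ?B" using assms(2) by (fastforce simp: incseq_def)
  ultimately have "(\<lambda>n. prob (?B n)) \<longlonglongrightarrow> prob (\<Union>n. ?B n)" by (rule finite_Lim_measure_incseq)
  then have "h \<longlonglongrightarrow> prob (\<Union>n. ?B n)" using assms(1) by simp
  then have "prob (\<Union>n. ?B n) = l" using assms(3) LIMSEQ_unique by blast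
  moreover have "(\<Union>n. ?B n) = {\<omega> \<in> space (P w). \<exists>i\<in>(\<Union>n. A n). X i \<omega> = v}" by auto
  ultimately show ?thesis by simp
qed

lemma prob_hitting: "\<P>(\<omega> in P w. \<exists>n. X n \<omega> = v) = Hit {v} {} w"
proof -
  have "\<P>(\<omega> in P w. \<exists>i\<in>{..n}. X i \<omega> = v) = hit n {v} {} w" for n
  proof -
    have "(\<exists>i\<in>{..n}. X i \<omega> = v) \<longleftrightarrow> (\<exists>y\<in>set (history n \<omega>). y \<in> {v})" for \<omega>
      by (auto simp: set_history)
    then show ?thesis using prob_history_event[of w "\<lambda>xs. \<exists>y\<in>set xs. y \<in> {v}" n] prob_path_hit[of n w "{v}"] by simp
  qed
  then have "\<P>(\<omega> in P w. \<exists>i\<in>(\<Union>n. {..n}). X i \<omega> = v) = Hit {v} {} w"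
    by (rule prob_ever) (auto simp: incseq_def hit_tendsto)
  moreover have "(\<Union>n. {..n}) = (UNIV :: nat set)" by auto
  ultimately show ?thesis by simp
qed

lemma prob_return: "\<P>(\<omega> in P w. \<exists>n\<ge>1. X n \<omega> = v) = step_op (Hit {v} {}) w"
proof -
  have "\<P>(\<omega> in P w. \<exists>i\<in>{1..Suc n}. X i \<omega> = v) = step_op (hit n {v} {}) w" for n
  proof -
    have "(\<exists>i\<in>{1..Suc n}. X i \<omega> = v) \<longleftrightarrow> (\<exists>y\<in>set (tl (history (Suc n) \<omega>)). y \<in> {v})" for \<omega>
      unfolding set_tl_history by auto
    then show ?thesis
      using prob_history_event[of w "\<lambda>xs. \<exists>y\<in>set (tl xs). y \<in> {v}" "Suc n"] prob_path_return[of n w "{v}"] by simp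
  qed
  then have "\<P>(\<omega> in P w. \<exists>i\<in>(\<Union>n. {1..Suc n}). X i \<omega> = v) = step_op (Hit {v} {}) w"
    by (rule prob_ever) (auto simp: incseq_def intro!: step_op_tendsto hit_tendsto)
  moreover have "x \<in> (\<Union>n. {1..Suc n}) \<longleftrightarrow> 1 \<le> x" for x by (auto intro!: exI[of _ x])
  ultimately show ?thesis by (simp only: Bex_def)
qed

lemma path_up:
  "xs \<in> set_pmf (path n w) \<Longrightarrow> (\<forall>y\<in>set xs. m \<le> length y) \<Longrightarrow> (w, last xs) \<in> (up m)\<^sup>* \<and> w \<in> set xs"
proof (induction n arbitrary: xs)
  case (Suc n)
  then obtain ys v where ys: "ys \<in> set_pmf (path n w)" "v \<in> set_pmf (K (last ys))" "xs = ys @ [v]" by auto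
  have "last ys \<in> set ys" using path_nonempty[OF ys(1)] by simp
  then have "(last ys, v) \<in> up m" using ys Suc.prems by (auto simp: up_def)
  moreover have "(w, last ys) \<in> (up m)\<^sup>* \<and> w \<in> set ys" using Suc.IH[OF ys(1)] Suc.prems ys by auto
  ultimately show ?case using ys by (auto intro: rtrancl.rtrancl_into_rtrancl)
qed auto

lemma transient_word_kernelI:
  assumes tr: "transient P X" and sy: "weakly_symmetric P X" and si: "suffix_irreducible P X"
  shows "transient_word_kernel p"
proof
  fix z x assume "z \<in> set_pmf (K x)"
  then have "0 < \<P>(\<omega> in P x. X 1 \<omega> = z)"
    unfolding prob_X_eq by (simp add: bind_return_pmf' pmf_positive)
  then have "0 < \<P>(\<omega> in P z. X 1 \<omega> = x)" using sy unfolding weakly_symmetric_def by blast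
  then show "x \<in> set_pmf (K z)" unfolding prob_X_eq by (simp add: bind_return_pmf' pmf_positive_iff)
next
  fix w n assume "w \<in> set_pmf (nstep n [])"
  then have "w \<in> walk_language P X" unfolding language_eq by blast
  then show "step_op (Hit {w} {}) w < 1" using tr unfolding transient_def prob_return by blast
next
  fix w a0 b0 n a b assume "w @ [a0, b0] \<in> set_pmf (nstep n [])"
  then have lang: "w @ [a0, b0] \<in> walk_language P X" unfolding language_eq by blast
  note irred = si[unfolded suffix_irreducible_def, THEN spec[where x = "w @ [a0, b0]"],
      THEN spec[where x = w], THEN spec[where x = a0], THEN spec[where x = b0], THEN mp, OF conjI[OF refl lang],
      THEN spec[where x = a], THEN spec[where x = b]]
  then obtain k w1 where "0 < \<P>(\<omega> in P (w @ [a0, b0]). X k \<omega> = w @ w1 @ [a, b] \<and>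
      (\<forall>i\<le>k. length (w @ [a0, b0]) \<le> length (X i \<omega>)))"
    by (elim exE) (rule that)
  also have "(\<lambda>\<omega>. X k \<omega> = w @ w1 @ [a, b] \<and> (\<forall>i\<le>k. length (w @ [a0, b0]) \<le> length (X i \<omega>))) =
      (\<lambda>\<omega>. last (history k \<omega>) = w @ w1 @ [a, b] \<and> (\<forall>y\<in>set (history k \<omega>). length w + 2 \<le> length y))"
    by (auto simp: last_history set_history fun_eq_iff)
  finally have "0 < measure_pmf.prob (path k (w @ [a0, b0])) {xs. last xs = w @ w1 @ [a, b] \<and> (\<forall>y\<in>set xs. length w + 2 \<le> length y)}"
    unfolding prob_history_event[of _ "\<lambda>xs. last xs = w @ w1 @ [a, b] \<and> (\<forall>y\<in>set xs. length w + 2 \<le> length y)"] .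
  \<comment> \<open>An event of positive probability contains a path of the support, which
    \<open>path_up\<close> reads as a chain in the graph \<open>up\<close>.\<close>
  then have "set_pmf (path k (w @ [a0, b0])) \<inter> {xs. last xs = w @ w1 @ [a, b] \<and> (\<forall>y\<in>set xs. length w + 2 \<le> length y)} \<noteq> {}"
    unfolding measure_pmf_zero_iff[symmetric] by (rule less_imp_neq[THEN not_sym])
  then obtain xs where "xs \<in> set_pmf (path k (w @ [a0, b0]))" "last xs = w @ w1 @ [a, b]" "\<forall>y\<in>set xs. length w + 2 \<le> length y"
    by blast
  then show "\<exists>w1. (w @ [a0, b0], w @ w1 @ [a, b]) \<in> (up (length w + 2))\<^sup>*"
    using path_up[of xs k "w @ [a0, b0]" "length w + 2"] by metis
qed

end

locale transient_language_walk = regular_language_walk p P X + transient_word_kernel p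
  for p :: "'a::finite list \<Rightarrow> 'a list pmf" and P :: "'a list \<Rightarrow> 'w measure" and X
begin

section \<open>Entropy as the speed in the Green distance\<close>

theorem entropy_eq_green_speed:
  "convergent (entropy_rate P X) \<and>
    (AE \<omega> in P []. (\<lambda>n. 1 / real n * green_dist P X [] (X n \<omega>)) \<longlonglongrightarrow> asymptotic_entropy P X)"
proof -
  interpret prob_space "P []" by (rule prob_space_P)
  obtain C where C: "\<And>x z. x \<in> lang \<Longrightarrow> z \<in> set_pmf (K x) \<Longrightarrow> \<bar>green z - green x\<bar> \<le> C"
    using green_lipschitz by blast
  obtain h where mean: "(\<lambda>n. (step_op ^^ n) green [] / real n) \<longlonglongrightarrow> h"
    and tails: "\<And>\<epsilon>. 0 < \<epsilon> \<Longrightarrow> summable (\<lambda>n. measure_pmf.prob (nstep n []) {z. real n * \<epsilon> \<le> \<bar>green z - real n * h\<bar>})"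
    using strong_law_of_small_oscillation[OF closed_lang C Nil_lang small_oscillation] by blast
  have dist: "green_dist P X [] x = green x" for x
    by (simp add: green_dist_def prob_hitting reach_prob_def)
  have ent: "entropy_rate P X n = - measure_pmf.expectation (nstep n []) (\<lambda>x. ln (pmf (nstep n []) x)) / n" for n
  proof -
    have "(\<integral>\<omega>. ln (walk_distribution P X n (X n \<omega>)) \<partial>P []) =
        (\<integral>x. ln (pmf (nstep n []) x) \<partial>distr (P []) (count_space UNIV) (X n))"
      by (subst integral_distr[OF measurable_X]) (auto simp: walk_distribution_def prob_X_eq)
    then show ?thesis by (simp add: entropy_rate_def distr_X)
  qed
  have len: "set_pmf (nstep n []) \<subseteq> {x. length x \<le> n}" for n
  proof -
    have "x \<in> set_pmf (nstep n y) \<Longrightarrow> length x \<le> length y + n" for x y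
    proof (induction n arbitrary: y)
      case (Suc n)
      then obtain z where "z \<in> set_pmf (K y)" "x \<in> set_pmf (nstep n z)" by auto
      then show ?case using Suc.IH[of z] K_length(1)[of z y] by simp
    qed simp
    then show ?thesis by fastforce
  qed
  obtain B where B: "0 < B" "\<And>n. (\<Sum>x | length x \<le> n. reach_prob x) \<le> B * (real n + 1)"
    using sum_reach_prob_words by blast
  \<comment> \<open>At \<open>n = 0\<close> both sides are 0, by the convention for division by
    zero.\<close>
  have low: "(step_op ^^ n) green [] / n \<le> entropy_rate P X n" for n
  proof -
    have "(step_op ^^ n) green [] \<le> - measure_pmf.expectation (nstep n []) (\<lambda>x. ln (pmf (nstep n []) x))"
      using entropy_sandwich(1)[OF finite_nstep finite_words len reach_prob_nonneg pmf_nstep_le_reach_prob, of n]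
      unfolding expectation_nstep .
    then show ?thesis unfolding ent by (rule divide_right_mono) simp
  qed
  have up: "entropy_rate P X n \<le> (step_op ^^ n) green [] / n + ln (B * (real n + 1)) / n" for n
  proof -
    have Z: "1 \<le> (\<Sum>x | length x \<le> n. reach_prob x)"
    proof -
      have "reach_prob [] \<le> (\<Sum>x | length x \<le> n. reach_prob x)"
        by (rule member_le_sum) (auto simp: reach_prob_nonneg finite_words)
      then show ?thesis by (simp add: reach_prob_def)
    qed
    then have "ln (\<Sum>x | length x \<le> n. reach_prob x) \<le> ln (B * (real n + 1))"
      using B by (intro ln_mono) auto
    then have "- measure_pmf.expectation (nstep n []) (\<lambda>x. ln (pmf (nstep n []) x)) \<le>
        (step_op ^^ n) green [] + ln (B * (real n + 1))"
      using entropy_sandwich(2)[OF finite_nstep finite_words len reach_prob_nonneg pmf_nstep_le_reach_prob, of n]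
      unfolding expectation_nstep by linarith
    then show ?thesis unfolding ent add_divide_distrib[symmetric] by (intro divide_right_mono) auto
  qed
  have "(\<lambda>n. ln (B * (real n + 1)) / n) \<longlonglongrightarrow> 0" using B(1) by real_asymp
  then have "(\<lambda>n. (step_op ^^ n) green [] / n + ln (B * (real n + 1)) / n) \<longlonglongrightarrow> h"
    using tendsto_add[OF mean] by fastforce
  then have ent_lim: "entropy_rate P X \<longlonglongrightarrow> h"
    by (rule tendsto_sandwich[OF always_eventually always_eventually mean, rotated 2]) (auto simp: low up)
  \<comment> \<open>\<open>asymptotic_entropy\<close> is a \<open>lim\<close>, so it gets this value
    from the convergence just shown.\<close>
  then have h: "asymptotic_entropy P X = h" unfolding asymptotic_entropy_def by (rule limI)
  \<comment> \<open>The accuracies \<open>1 / Suc k\<close> reduce the limit to countably many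
    almost sure events, one Borel-Cantelli argument for each.\<close>
  have "AE \<omega> in P []. \<forall>k. eventually (\<lambda>n. \<bar>green (X n \<omega>) - real n * h\<bar> < real n * (1 / Suc k)) sequentially"
  proof (subst AE_all_countable, rule allI)
    fix k
    let ?A = "\<lambda>n. {\<omega> \<in> space (P []). real n * (1 / Suc k) \<le> \<bar>green (X n \<omega>) - real n * h\<bar>}"
    have "AE \<omega> in P []. eventually (\<lambda>n. \<omega> \<in> space (P []) - ?A n) sequentially"
    proof (rule borel_cantelli_AE1)
      show "?A n \<in> sets (P [])" for n by (rule measurable_X_event)
      show "emeasure (P []) (?A n) < \<infinity>" for n by (simp add: emeasure_eq_measure)
      have "prob (?A n) = measure_pmf.prob (nstep n []) {z. real n * (1 / Suc k) \<le> \<bar>green z - real n * h\<bar>}" for n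
        by (rule prob_X)
      then show "summable (\<lambda>n. prob (?A n))" using tails[of "1 / Suc k"] by simp
    qed
    then show "AE \<omega> in P []. eventually (\<lambda>n. \<bar>green (X n \<omega>) - real n * h\<bar> < real n * (1 / Suc k)) sequentially"
      by eventually_elim (auto elim!: eventually_mono simp: not_le)
  qed
  then have "AE \<omega> in P []. (\<lambda>n. 1 / real n * green (X n \<omega>)) \<longlonglongrightarrow> h"
  proof eventually_elim
    case (elim \<omega>)
    show ?case
    proof (rule tendstoI)
      fix e :: real assume "0 < e"
      then obtain k where k: "1 / Suc k < e" using nat_approx_posE by blast
      show "eventually (\<lambda>n. dist (1 / real n * green (X n \<omega>)) h < e) sequentially"
        using elim[rule_format, of k] eventually_gt_at_top[of 0]
      proof eventually_elim
        case (elim n)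
        have "real n * \<bar>1 / real n * green (X n \<omega>) - h\<bar> = \<bar>green (X n \<omega>) - real n * h\<bar>"
          using elim(2) by (simp add: abs_mult[symmetric, of "real n", simplified] field_simps)
        then have "real n * \<bar>1 / real n * green (X n \<omega>) - h\<bar> < real n * (1 / Suc k)" using elim(1) by simp
        then have "\<bar>1 / real n * green (X n \<omega>) - h\<bar> < 1 / Suc k" using elim(2) by (simp only: mult_less_cancel_left_pos of_nat_0_less_iff)
        then show ?case using k by (simp only: dist_real_def)
      qed
    qed
  qed
  then show ?thesis using ent_lim unfolding dist h convergent_def by blast
qed

end

theorem corollary2p8:
  fixes p :: "'a::finite list \<Rightarrow> 'a list pmf"
    and P :: "'a list \<Rightarrow> 'w measure"
    and X :: "nat \<Rightarrow> 'w \<Rightarrow> 'a list"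
  assumes "regular_language_walk p P X"
    and "transient P X"
    and "weakly_symmetric P X"
    and "suffix_irreducible P X"
  shows "convergent (entropy_rate P X) \<and>
    (AE \<omega> in P []. (\<lambda>n. 1 / real n * green_dist P X [] (X n \<omega>)) \<longlonglongrightarrow> asymptotic_entropy P X)"
proof -
  interpret regular_language_walk p P X by fact
  interpret transient_language_walk p P X
    by (intro transient_language_walk.intro transient_word_kernelI) fact+
  show ?thesis by (rule entropy_eq_green_speed)
qed

end
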